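(* For even $n$, the threshold for the random graph $G(n,p)$ to contain a copy of $C^{e}_{4,n}$ is $\Theta(n^{-2/3})$. That is, there is a threshold function $p^*(n)=\Theta(n^{-2/3})$ such that $\mathbb{P}[G(n,p)\text{ contains a copy of }C^{e}_{4,n}]\to 0$ if $p=o(p^* )$ and $\to 1$ if $p=\omega(p^* )$.
   Context: For even $n\ge 6$, $C^{e}_{4,n}$ is the graph defined as follows: take vertices labelled $v_1,\dots,v_n$; add the matching edges $v_{2i-1}v_{2i}$ for $i\in\{1,\dots,n/2\}$; add the cycle $v_1v_3v_5\cdots v_{n-1}v_1$ on the odd-indexed vertices and the cycle $v_2v_4\cdots v_nv_2$ on the even-indexed vertices. Equivalently, it consists of the $n/2$ cyclically ordered copies of $C_4$ with edge sets $\{v_{2i-1}v_{2i},v_{2i+1}v_{2i+2},v_{2i-1}v_{2i+1},v_{2i}v_{2i+2}\}$ (indices modulo $n$), consecutive copies overlapping in exactly one edge, these overlapping edges being pairwise disjoint. It is a spanning $3$-regular graph with $3n/2$ edges. $G(n,p)$ is the binomial random graph on $n$ vertices. *)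

theory Defs
  imports "HOL-Probability.Probability" "HOL-Library.Landau_Symbols"
begin

type_synonym 'a graph = "'a set \<times> 'a set set"

definition contains_copy :: "'a graph \<Rightarrow> 'b graph \<Rightarrow> bool" where
  "contains_copy G H \<longleftrightarrow>
     (\<exists>\<phi>. inj_on \<phi> (fst H) \<and> \<phi> ` fst H \<subseteq> fst G \<and> (\<forall>e\<in>snd H. \<phi> ` e \<in> snd G))"

definition all_pairs :: "'a set \<Rightarrow> 'a set set" where
  "all_pairs V = {e. e \<subseteq> V \<and> card e = 2}"

definition gnp :: "nat \<Rightarrow> real \<Rightarrow> nat graph pmf" where
  "gnp n p = map_pmf (\<lambda>X. ({1..n}, {e \<in> all_pairs {1..n}. X e}))
     (Pi_pmf (all_pairs {1..n}) False (\<lambda>_. bernoulli_pmf p))"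

text \<open>The edge set of the closed walk \<open>w 1, w 2, \<dots>, w k, w 1\<close>.\<close>

definition cycle_edges :: "(nat \<Rightarrow> 'a) \<Rightarrow> nat \<Rightarrow> 'a set set" where
  "cycle_edges w k = (\<lambda>i. {w i, w (i mod k + 1)}) ` {1..k}"

text \<open>The vertex \<open>v\<^sub>j\<close> is the number \<open>j\<close>. The definition is only meaningful for even \<open>n \<ge> 6\<close>.\<close>

definition C4e :: "nat \<Rightarrow> nat graph" where
  "C4e n = ({1..n},
     (\<lambda>i. {2 * i - 1, 2 * i}) ` {1..n div 2}
     \<union> cycle_edges (\<lambda>i. 2 * i - 1) (n div 2)
     \<union> cycle_edges (\<lambda>i. 2 * i) (n div 2))"

definition even_at_top :: "nat filter" where
  "even_at_top = inf at_top (principal {n. even n})"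

text \<open>\<open>F\<close> is the filter along which \<open>n\<close> tends to infinity, and \<open>A n\<close> is the event considered for the
  random graph on \<open>n\<close> vertices.\<close>

definition is_threshold :: "nat filter \<Rightarrow> (nat \<Rightarrow> nat graph set) \<Rightarrow> (nat \<Rightarrow> real) \<Rightarrow> bool" where
  "is_threshold F A pstar \<longleftrightarrow>
     (\<forall>p. (\<forall>n. 0 \<le> p n \<and> p n \<le> 1) \<longrightarrow>
        (p \<in> o[F](pstar) \<longrightarrow> ((\<lambda>n. measure_pmf.prob (gnp n (p n)) (A n)) \<longlongrightarrow> 0) F) \<and>
        (p \<in> \<omega>[F](pstar) \<longrightarrow> ((\<lambda>n. measure_pmf.prob (gnp n (p n)) (A n)) \<longlongrightarrow> 1) F))"

end

theory Submission
  imports Defs "HOL-Combinatorics.Permutations"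
begin

text \<open>
  Below the threshold the union bound over the \<open>n!\<close> embeddings suffices. Above it, expose the random graph
  in three rounds and follow the minimum fragments of the copies: if \<open>W\<close> is the set exposed in a round, replace
  each surviving piece \<open>T i\<close> by a smallest set \<open>T j - W\<close> with \<open>T j \<subseteq> T i \<union> W\<close>. The expected number of
  fragments with \<open>t\<close> edges is at most \<open>p\<^sup>-\<^sup>t\<close> times the largest sum over the edge sets \<open>I \<subseteq> T j\<close> with
  \<open>t\<close> edges of the number of copies containing \<open>I\<close>.

  If \<open>I\<close> has rank \<open>r\<close>, then a random copy contains \<open>I\<close> with probability at most \<open>C\<^sup>t n\<^sup>-\<^sup>r\<close>. Cut the
  graph into \<open>n/2\<close> cyclically ordered cells of three edges; if the nonempty cells of \<open>I\<close> form \<open>c\<close> cyclic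
  intervals, then \<open>3 r \<ge> 2 t + c\<close>, whereas a set of \<open>k\<close> edges has at most \<open>C\<^sup>t\<close> times \<open>k\<close>
  choose \<open>c\<close> subsets \<open>I\<close> of this kind. Hence the sum is at most \<open>n! (C n\<^bsup>-2/3\<^esup>)\<^sup>t exp (k n\<^bsup>-1/3\<^esup>)\<close>,
  and the exponential factor is absorbed as soon as \<open>t\<close> is of order \<open>k n\<^bsup>-1/3\<^esup>\<close>. So the sizes of the
  pieces drop from order \<open>n\<close> to order \<open>n\<^bsup>2/3\<^esup>\<close>, then to a small multiple of \<open>n\<^bsup>1/3\<^esup>\<close>, then
  to zero.
\<close>

section \<open>Random subsets of a finite set\<close>

text \<open>This is the expectation of \<open>f\<close> under the binomial random subset of
  \<open>M\<close>. As a finite sum it allows induction on \<open>M\<close> in place of measure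
  theory; the link to \<open>gnp\<close> is made once, through
  \<open>prob_Pi_pmf_bernoulli\<close>.\<close>

definition bern_exp :: "'a set \<Rightarrow> real \<Rightarrow> ('a set \<Rightarrow> real) \<Rightarrow> real" where
  "bern_exp M p f = (\<Sum>W\<in>Pow M. p ^ card W * (1 - p) ^ card (M - W) * f W)"

lemma bern_exp_insert:
  assumes "finite M" "a \<notin> M"
  shows "bern_exp (insert a M) p f = (1 - p) * bern_exp M p f + p * bern_exp M p (\<lambda>W. f (insert a W))"
proof -
  have disj: "Pow M \<inter> insert a ` Pow M = {}" using assms by auto
  have inj: "inj_on (insert a) (Pow M)"
    using assms by (auto simp: inj_on_def)
  have 1: "(\<Sum>W\<in>Pow M. p ^ card W * (1 - p) ^ card (insert a M - W) * f W) = (1 - p) * bern_exp M p f"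
    unfolding bern_exp_def sum_distrib_left
  proof (rule sum.cong[OF refl])
    fix W assume W: "W \<in> Pow M"
    then have "insert a M - W = insert a (M - W)" using assms by auto
    then have "card (insert a M - W) = Suc (card (M - W))" using assms by simp
    then show "p ^ card W * (1 - p) ^ card (insert a M - W) * f W =
      (1 - p) * (p ^ card W * (1 - p) ^ card (M - W) * f W)" by simp
  qed
  have 2: "(\<Sum>W\<in>insert a ` Pow M. p ^ card W * (1 - p) ^ card (insert a M - W) * f W) =
     p * bern_exp M p (\<lambda>W. f (insert a W))"
    unfolding bern_exp_def sum_distrib_left sum.reindex[OF inj] o_def
  proof (rule sum.cong[OF refl])
    fix W assume W: "W \<in> Pow M"
    then have "insert a M - insert a W = M - W" using assms by auto
    moreover have "card (insert a W) = Suc (card W)"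
      using W assms finite_subset by (metis PowD card_insert_disjoint subset_iff)
    ultimately show "p ^ card (insert a W) * (1 - p) ^ card (insert a M - insert a W) * f (insert a W) =
      p * (p ^ card W * (1 - p) ^ card (M - W) * f (insert a W))" by simp
  qed
  show ?thesis
    unfolding bern_exp_def[of "insert a M"] Pow_insert
    by (subst sum.union_disjoint) (use assms disj 1 2 in auto)
qed

lemma bern_exp_empty [simp]: "bern_exp {} p f = f {}"
  by (simp add: bern_exp_def)

lemma bern_exp_add: "bern_exp M p (\<lambda>W. f W + g W) = bern_exp M p f + bern_exp M p g"
  by (simp add: bern_exp_def sum.distrib algebra_simps)

lemma bern_exp_cmult: "bern_exp M p (\<lambda>W. c * f W) = c * bern_exp M p f"
  by (simp add: bern_exp_def sum_distrib_left algebra_simps)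

lemma bern_exp_sum: "bern_exp M p (\<lambda>W. \<Sum>i\<in>A. f i W) = (\<Sum>i\<in>A. bern_exp M p (f i))"
  unfolding bern_exp_def by (simp add: sum_distrib_left) (rule sum.swap)

lemma bern_exp_mono:
  assumes "0 \<le> p" "p \<le> 1" "\<And>W. W \<subseteq> M \<Longrightarrow> f W \<le> g W"
  shows "bern_exp M p f \<le> bern_exp M p g"
  unfolding bern_exp_def by (intro sum_mono mult_left_mono) (use assms in auto)

lemma bern_exp_const: "finite M \<Longrightarrow> bern_exp M p (\<lambda>_. c) = c"
  by (induction M rule: finite_induct) (auto simp: bern_exp_insert algebra_simps)

text \<open>Exposure in two rounds: an element is missed by both sets with probability
  \<open>(1 - p) * (1 - q)\<close>. The induction conditions on one element at a time, so the
  hypothesis is needed for all \<open>f\<close>.\<close>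

lemma bern_exp_union:
  assumes "finite M"
  shows "bern_exp M p (\<lambda>W. bern_exp M q (\<lambda>W'. f (W \<union> W'))) = bern_exp M (1 - (1 - p) * (1 - q)) f"
  using assms
proof (induction M arbitrary: f rule: finite_induct)
  case (insert a M)
  show ?case
    by (simp add: bern_exp_insert insert.hyps insert.IH[symmetric] bern_exp_add bern_exp_cmult)
       (simp add: algebra_simps)
qed simp

lemma bern_exp_superset_prob:
  assumes "finite M" "S \<subseteq> M"
  shows "bern_exp M p (\<lambda>W. of_bool (S \<subseteq> W)) = p ^ card S"
  using assms
proof (induction M arbitrary: S rule: finite_induct)
  case (insert a M)
  have fin: "finite S" using insert finite_subset by blast
  show ?case
  proof (cases "a \<in> S")
    case True
    have z: "bern_exp M p (\<lambda>W. of_bool (S \<subseteq> W)) = 0"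
      unfolding bern_exp_def using True insert.hyps by (intro sum.neutral) auto
    have "bern_exp M p (\<lambda>W. of_bool (S - {a} \<subseteq> W)) = p ^ card (S - {a})"
      using insert by (intro insert.IH) auto
    moreover have "card S = Suc (card (S - {a}))"
      using True fin by (metis card_Suc_Diff1)
    moreover have "(S \<subseteq> insert a W) = (S - {a} \<subseteq> W)" for W by auto
    ultimately show ?thesis
      by (simp only: bern_exp_insert[OF insert.hyps(1,2)] z) simp
  next
    case False
    then have "S \<subseteq> M" using insert by auto
    then have "bern_exp M p (\<lambda>W. of_bool (S \<subseteq> W)) = p ^ card S" by (rule insert.IH)
    moreover have "(S \<subseteq> insert a W) = (S \<subseteq> W)" for W using False by auto
    ultimately show ?thesis
      by (simp only: bern_exp_insert[OF insert.hyps(1,2)]) (simp add: algebra_simps)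
  qed
qed simp

lemma prob_Pi_pmf_bernoulli:
  assumes "finite M" "0 \<le> p" "p \<le> 1"
  shows "measure_pmf.prob (Pi_pmf M False (\<lambda>_. bernoulli_pmf p)) {X. P {e \<in> M. X e}} =
         bern_exp M p (\<lambda>W. of_bool (P W))"
proof -
  let ?R = "map_pmf (\<lambda>X. {e \<in> M. X e}) (Pi_pmf M False (\<lambda>_. bernoulli_pmf p))"
  have pmf: "pmf ?R W = p ^ card W * (1 - p) ^ card (M - W)" if W: "W \<subseteq> M" for W
  proof -
    \<comment> \<open>Outside \<open>M\<close> the product takes the default value
      \<open>False\<close>, so almost surely only the indicator function of \<open>W\<close> lies in
      the fibre over \<open>W\<close>.\<close>
    have "pmf ?R W = measure_pmf.prob (Pi_pmf M False (\<lambda>_. bernoulli_pmf p)) {\<lambda>e. e \<in> W}"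
      unfolding pmf_map
    proof (rule measure_pmf.finite_measure_eq_AE)
      show "AE x in measure_pmf (Pi_pmf M False (\<lambda>_. bernoulli_pmf p)).
        (x \<in> (\<lambda>X. {e \<in> M. X e}) -` {W}) = (x \<in> {\<lambda>e. e \<in> W})"
        unfolding AE_measure_pmf_iff
      proof
        fix x assume "x \<in> set_pmf (Pi_pmf M False (\<lambda>_. bernoulli_pmf p))"
        then have "\<And>e. e \<notin> M \<Longrightarrow> \<not> x e"
          using set_Pi_pmf_subset[OF assms(1)] by fastforce
        then show "(x \<in> (\<lambda>X. {e \<in> M. X e}) -` {W}) = (x \<in> {\<lambda>e. e \<in> W})"
          using W by (auto simp: fun_eq_iff)
      qed
    qed auto
    also have "\<dots> = pmf (Pi_pmf M False (\<lambda>_. bernoulli_pmf p)) (\<lambda>e. e \<in> W)"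
      by (simp add: measure_pmf_single)
    also have "\<dots> = (\<Prod>e\<in>M. pmf (bernoulli_pmf p) (e \<in> W))"
      using W assms(1) by (intro pmf_Pi') auto
    also have "\<dots> = (\<Prod>e\<in>W. pmf (bernoulli_pmf p) (e \<in> W)) * (\<Prod>e\<in>M - W. pmf (bernoulli_pmf p) (e \<in> W))"
      by (subst prod.subset_diff[OF W assms(1)]) (rule mult.commute)
    also have "\<dots> = p ^ card W * (1 - p) ^ card (M - W)"
      using assms by simp
    finally show ?thesis .
  qed
  have sub: "set_pmf ?R \<subseteq> Pow M" by auto
  have "measure_pmf.prob (Pi_pmf M False (\<lambda>_. bernoulli_pmf p)) {X. P {e \<in> M. X e}} =
    measure_pmf.prob ?R {W. P W}"
    by (simp add: vimage_def)
  also have "\<dots> = measure_pmf.prob ?R {W \<in> Pow M. P W}"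
    using sub by (intro measure_pmf.finite_measure_eq_AE) (auto simp: AE_measure_pmf_iff)
  also have "\<dots> = (\<Sum>W\<in>{W \<in> Pow M. P W}. pmf ?R W)"
    using assms(1) by (intro measure_measure_pmf_finite) auto
  also have "\<dots> = bern_exp M p (\<lambda>W. of_bool (P W))"
    unfolding bern_exp_def using assms(1)
    by (intro sum.mono_neutral_cong_left) (auto simp: pmf)
  finally show ?thesis .
qed

section \<open>Minimum fragments\<close>

text \<open>A minimum fragment: what is still missing from a member of the family that fits into \<open>T i \<union> W\<close>.\<close>

definition fragment :: "('i \<Rightarrow> 'a set) \<Rightarrow> 'i set \<Rightarrow> 'i \<Rightarrow> 'a set \<Rightarrow> 'a set" where
  "fragment T G i W = (ARG_MIN card F. F \<in> {T j - W | j. j \<in> G \<and> T j \<subseteq> T i \<union> W})"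

lemma fragment_ex:
  assumes "i \<in> G"
  shows "\<exists>j\<in>G. T j \<subseteq> T i \<union> W \<and> fragment T G i W = T j - W"
proof -
  have "fragment T G i W \<in> {T j - W | j. j \<in> G \<and> T j \<subseteq> T i \<union> W}"
    unfolding fragment_def
    by (rule arg_min_natI[where P = "\<lambda>F. F \<in> {T j - W | j. j \<in> G \<and> T j \<subseteq> T i \<union> W}" and k = "T i - W"])
       (use assms in auto)
  then show ?thesis by auto
qed

lemma fragment_min:
  assumes "j \<in> G" "T j \<subseteq> T i \<union> W"
  shows "card (fragment T G i W) \<le> card (T j - W)"
  unfolding fragment_def
  by (rule arg_min_nat_le[where P = "\<lambda>F. F \<in> {T j - W | j. j \<in> G \<and> T j \<subseteq> T i \<union> W}"])
     (use assms in auto)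

text \<open>The pair \<open>(W, i)\<close> is recovered from \<open>Z = W \<union> F\<close>, \<open>i\<close> and the fragment \<open>F\<close>, and by minimality \<open>F\<close> lies in
  every member of the family inside \<open>Z\<close>, in particular in one that is chosen as a function of \<open>Z\<close> alone.\<close>

lemma fragment_count_le:
  assumes M: "finite M" and p: "0 < p" "p \<le> 1" and G: "finite G"
    and T: "\<And>i. i \<in> G \<Longrightarrow> T i \<subseteq> M"
    and \<beta>: "\<And>j. j \<in> G \<Longrightarrow> (\<Sum>i\<in>G. real (card (T i \<inter> T j) choose t)) \<le> \<beta>" "0 \<le> \<beta>"
  shows "bern_exp M p (\<lambda>W. real (card {i \<in> G. card (fragment T G i W) = t})) \<le> \<beta> / p ^ t"
proof -
  define wt where "wt W = p ^ card W * (1 - p) ^ card (M - W)" for W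
  define J where "J Z = (SOME j. j \<in> G \<and> T j \<subseteq> Z)" for Z
  define \<Z> where "\<Z> = {Z \<in> Pow M. \<exists>j\<in>G. T j \<subseteq> Z}"
  let ?F = "fragment T G"
  have wt0: "wt W \<ge> 0" for W using p by (simp add: wt_def)
  have J: "J Z \<in> G" "T (J Z) \<subseteq> Z" if "Z \<in> \<Z>" for Z
    using that someI_ex[of "\<lambda>j. j \<in> G \<and> T j \<subseteq> Z"] by (auto simp: J_def \<Z>_def)
  define A where "A = (SIGMA W:Pow M. {i \<in> G. card (?F i W) = t})"
  define B where "B = (SIGMA Z:\<Z>. SIGMA i:G. {I. I \<subseteq> T i \<inter> T (J Z) \<and> card I = t})"
  have finT: "finite (T i)" if "i \<in> G" for i using T[OF that] M finite_subset by blast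
  have fin\<Z>: "finite \<Z>" using M by (auto simp: \<Z>_def)
  have finB: "finite B"
    unfolding B_def using fin\<Z> G finT by (intro finite_SigmaI) auto
  have finA: "finite A"
    unfolding A_def using M G by (intro finite_SigmaI) auto
  define h where "h = (\<lambda>(W, i). (W \<union> ?F i W, i, ?F i W))"
  have frag: "?F i W \<inter> W = {}" "?F i W \<subseteq> M" "?F i W \<subseteq> T i" "W \<union> ?F i W \<in> \<Z>" "?F i W \<subseteq> T (J (W \<union> ?F i W))"
    if "W \<subseteq> M" "i \<in> G" for W i
  proof -
    obtain j where j: "j \<in> G" "T j \<subseteq> T i \<union> W" "?F i W = T j - W"
      using fragment_ex[OF \<open>i \<in> G\<close>] by metis
    show 1: "?F i W \<inter> W = {}" "?F i W \<subseteq> M" "?F i W \<subseteq> T i" using j T by auto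
    show 2: "W \<union> ?F i W \<in> \<Z>" using j T that by (auto simp: \<Z>_def)
    let ?j = "J (W \<union> ?F i W)"
    have j': "?j \<in> G" "T ?j \<subseteq> W \<union> ?F i W" using J[OF 2] by auto
    \<comment> \<open>The set \<open>T ?j\<close> lies inside \<open>T i \<union> W\<close> and
      therefore competes in the minimum defining the fragment. Since \<open>T ?j - W\<close> is also
      contained in the fragment, the two coincide.\<close>
    have "card (?F i W) \<le> card (T ?j - W)"
      using j' 1 by (intro fragment_min) auto
    moreover have "T ?j - W \<subseteq> ?F i W" using j' by auto
    moreover have "finite (?F i W)" using 1 M finite_subset by blast
    ultimately have "T ?j - W = ?F i W" by (meson card_seteq)
    then show "?F i W \<subseteq> T ?j" by auto
  qed
  have inj: "inj_on h A"
  proof (rule inj_onI, clarify)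
    fix W i W' i' assume a: "(W, i) \<in> A" "(W', i') \<in> A" and eq: "h (W, i) = h (W', i')"
    have "i = i'" "W \<union> ?F i W = W' \<union> ?F i' W'" "?F i W = ?F i' W'" using eq by (auto simp: h_def)
    moreover have "?F i W \<inter> W = {}" "?F i' W' \<inter> W' = {}" using a frag(1) by (auto simp: A_def)
    ultimately show "W = W' \<and> i = i'" by blast
  qed
  have img: "h ` A \<subseteq> B"
    using frag(3-5) by (fastforce simp: h_def A_def B_def)
  \<comment> \<open>Adding the \<open>t\<close> elements of the fragment to \<open>W\<close> trades
    \<open>t\<close> factors \<open>1 - p\<close> for factors \<open>p\<close>. The former are at
    most 1, so the price is \<open>1 / p ^ t\<close>.\<close>
  have wt_le: "wt W \<le> wt (fst (h (W, i))) / p ^ t" if a: "(W, i) \<in> A" for W i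
  proof -
    have W: "W \<subseteq> M" "i \<in> G" "card (?F i W) = t" using a by (auto simp: A_def)
    have f: "finite W" "finite (?F i W)" using W frag(2)[OF W(1,2)] M finite_subset by blast+
    have c1: "card (W \<union> ?F i W) = card W + t"
      using f frag(1)[OF W(1,2)] W(3) by (subst card_Un_disjoint) auto
    have "M - W = (M - (W \<union> ?F i W)) \<union> ?F i W" using frag(1,2)[OF W(1,2)] by auto
    then have c2: "card (M - W) = card (M - (W \<union> ?F i W)) + t"
      using f M W(3) card_Un_disjoint[of "M - (W \<union> ?F i W)" "?F i W"] by fastforce
    have "wt W = p ^ card W * (1 - p) ^ card (M - (W \<union> ?F i W)) * (1 - p) ^ t"
      by (simp add: wt_def c2 power_add)
    also have "\<dots> \<le> p ^ card W * (1 - p) ^ card (M - (W \<union> ?F i W)) * 1"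
      using p by (intro mult_left_mono power_le_one) auto
    also have "\<dots> = wt (fst (h (W, i))) / p ^ t"
      using p by (simp add: wt_def h_def c1 power_add)
    finally show ?thesis .
  qed
  have "bern_exp M p (\<lambda>W. real (card {i \<in> G. card (?F i W) = t})) = (\<Sum>W\<in>Pow M. \<Sum>i\<in>{i \<in> G. card (?F i W) = t}. wt W)"
    unfolding bern_exp_def wt_def by (simp add: mult_ac)
  also have "\<dots> = (\<Sum>(W, i)\<in>A. wt W)"
    unfolding A_def using M G by (intro sum.Sigma) auto
  also have "\<dots> \<le> (\<Sum>x\<in>A. wt (fst (h x)) / p ^ t)"
    using wt_le by (intro sum_mono) auto
  also have "\<dots> = (\<Sum>z\<in>h ` A. wt (fst z) / p ^ t)"
    by (simp add: sum.reindex[OF inj])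
  also have "\<dots> \<le> (\<Sum>z\<in>B. wt (fst z) / p ^ t)"
    using finB img wt0 p by (intro sum_mono2) auto
  also have "\<dots> = (\<Sum>Z\<in>\<Z>. \<Sum>y\<in>(SIGMA i:G. {I. I \<subseteq> T i \<inter> T (J Z) \<and> card I = t}). wt Z / p ^ t)"
    unfolding B_def using fin\<Z> G finT
    by (subst sum.Sigma) (auto intro!: finite_SigmaI simp: case_prod_beta)
  also have "\<dots> = (\<Sum>Z\<in>\<Z>. wt Z / p ^ t * (\<Sum>i\<in>G. real (card (T i \<inter> T (J Z)) choose t)))"
  proof (rule sum.cong[OF refl])
    fix Z assume "Z \<in> \<Z>"
    have "card (SIGMA i:G. {I. I \<subseteq> T i \<inter> T (J Z) \<and> card I = t}) = (\<Sum>i\<in>G. card {I. I \<subseteq> T i \<inter> T (J Z) \<and> card I = t})"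
      using G finT by (intro card_SigmaI) auto
    also have "\<dots> = (\<Sum>i\<in>G. card (T i \<inter> T (J Z)) choose t)"
      using finT by (intro sum.cong refl n_subsets) auto
    finally show "(\<Sum>y\<in>(SIGMA i:G. {I. I \<subseteq> T i \<inter> T (J Z) \<and> card I = t}). wt Z / p ^ t) =
       wt Z / p ^ t * (\<Sum>i\<in>G. real (card (T i \<inter> T (J Z)) choose t))" by simp
  qed
  also have "\<dots> \<le> (\<Sum>Z\<in>\<Z>. wt Z / p ^ t * \<beta>)"
    using \<beta> J wt0 p by (intro sum_mono mult_left_mono) auto
  also have "\<dots> = (\<Sum>Z\<in>\<Z>. wt Z) * (\<beta> / p ^ t)"
    by (simp add: sum_distrib_right sum_divide_distrib)
  also have "\<dots> \<le> (\<Sum>Z\<in>Pow M. wt Z) * (\<beta> / p ^ t)"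
    using wt0 p \<beta>(2) M by (intro mult_right_mono sum_mono2) (auto simp: \<Z>_def)
  also have "(\<Sum>Z\<in>Pow M. wt Z) = 1"
    using bern_exp_const[OF M, of p 1] by (simp add: bern_exp_def wt_def)
  finally show ?thesis by simp
qed

text \<open>\<open>G\<close> and \<open>T\<close> stand for the surviving indices and pieces after earlier rounds: at least a fraction \<open>g\<close> of the
  index set survives, and each piece has at most \<open>k\<close> elements.\<close>

definition covering_failure_bound ::
  "'a set \<Rightarrow> 'i set \<Rightarrow> ('i \<Rightarrow> 'a set) \<Rightarrow> real \<Rightarrow> real \<Rightarrow> real \<Rightarrow> real \<Rightarrow> bool" where
  "covering_failure_bound M X S p k g \<epsilon> \<longleftrightarrow>
     (\<forall>G T. G \<subseteq> X \<and> (\<forall>i\<in>G. T i \<subseteq> S i \<and> real (card (T i)) \<le> k) \<and> g * real (card X) \<le> real (card G) \<longrightarrow>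
        bern_exp M p (\<lambda>W. of_bool (\<not> (\<exists>i\<in>G. T i \<subseteq> W))) \<le> \<epsilon>)"

text \<open>Expose \<open>W\<close> with probability \<open>p\<close> and pass to fragments. By
  \<open>fragment_count_le\<close>, \<open>spread\<close> makes the expected number of fragments
  larger than \<open>k'\<close> a small multiple of \<open>card X\<close>. Unless these use up a
  quarter of \<open>card X\<close>, the other fragments form a legitimate input for the next round,
  and a fragment covered there completes some \<open>T j\<close>.\<close>

lemma covering_failure_bound_step:
  assumes M: "finite M" and X: "finite X" "X \<noteq> {}" and S: "\<And>i. i \<in> X \<Longrightarrow> S i \<subseteq> M"
    and p: "0 < p" "p \<le> 1" and q: "0 \<le> q" "q \<le> 1" and \<theta>: "0 \<le> \<theta>" "\<theta> \<le> p / 2"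
    and k': "0 \<le> k'"
    and spread: "\<And>j A t. j \<in> X \<Longrightarrow> A \<subseteq> S j \<Longrightarrow> real (card A) \<le> k \<Longrightarrow> 1 \<le> t \<Longrightarrow> k' \<le> real t \<Longrightarrow>
       (\<Sum>i\<in>X. real (card (S i \<inter> A) choose t)) \<le> real (card X) * \<theta> ^ t"
    and next_round: "covering_failure_bound M X S q k' g \<epsilon>" and \<epsilon>: "0 \<le> \<epsilon>"
  shows "covering_failure_bound M X S (1 - (1 - p) * (1 - q)) k (g + 1 / 4) (\<epsilon> + 8 * \<theta> / p)"
  unfolding covering_failure_bound_def
proof (intro allI impI, elim conjE)
  fix G T
  assume G: "G \<subseteq> X" and T: "\<forall>i\<in>G. T i \<subseteq> S i \<and> real (card (T i)) \<le> k"
    and cG: "(g + 1 / 4) * real (card X) \<le> real (card G)"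
  let ?F = "fragment T G"
  have finG: "finite G" using G X finite_subset by blast
  have TM: "T i \<subseteq> M" if "i \<in> G" for i using T S G that by blast
  have finT: "finite (T i)" if "i \<in> G" for i using TM[OF that] M finite_subset by blast
  have N0: "real (card X) > 0" using X by (simp add: card_gt_0_iff)
  define bad where "bad W = {i \<in> G. \<not> real (card (?F i W)) \<le> k'}" for W
  \<comment> \<open>These are the sizes of bad fragments. As \<open>k'\<close> is nonnegative they
    start at 1, so the geometric sum below is of order \<open>\<theta> / p\<close>.\<close>
  define D where "D = {t \<in> {1..card M}. k' < real t}"
  have FM: "?F i W \<subseteq> M" if "i \<in> G" for i W
    using fragment_ex[OF that, of T W] TM by blast
  have count: "bern_exp M p (\<lambda>W. real (card {i \<in> G. card (?F i W) = t})) \<le> real (card X) * (\<theta> / p) ^ t"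
    if t: "t \<in> D" for t
  proof -
    have "bern_exp M p (\<lambda>W. real (card {i \<in> G. card (?F i W) = t})) \<le> real (card X) * \<theta> ^ t / p ^ t"
    proof (rule fragment_count_le[OF M p finG TM])
      fix j assume j: "j \<in> G"
      have "(\<Sum>i\<in>G. real (card (T i \<inter> T j) choose t)) \<le> (\<Sum>i\<in>G. real (card (S i \<inter> T j) choose t))"
        using T finT j by (intro sum_mono of_nat_mono binomial_right_mono card_mono) auto
      also have "\<dots> \<le> (\<Sum>i\<in>X. real (card (S i \<inter> T j) choose t))"
        using G X by (intro sum_mono2) auto
      also have "\<dots> \<le> real (card X) * \<theta> ^ t"
        using j G T t by (intro spread[of j]) (auto simp: D_def)
      finally show "(\<Sum>i\<in>G. real (card (T i \<inter> T j) choose t)) \<le> real (card X) * \<theta> ^ t" .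
    qed (use \<theta> in auto)
    then show ?thesis by (simp add: power_divide)
  qed
  have bad_eq: "real (card (bad W)) \<le> (\<Sum>t\<in>D. real (card {i \<in> G. card (?F i W) = t}))" for W
  proof -
    have "bad W \<subseteq> (\<Union>t\<in>D. {i \<in> G. card (?F i W) = t})"
    proof
      fix i assume i: "i \<in> bad W"
      have "card (?F i W) \<le> card M" using FM i M by (intro card_mono) (auto simp: bad_def)
      then show "i \<in> (\<Union>t\<in>D. {i \<in> G. card (?F i W) = t})"
        using i k' by (auto simp: bad_def D_def Suc_le_eq intro!: gr0I)
    qed
    then have "card (bad W) \<le> card (\<Union>t\<in>D. {i \<in> G. card (?F i W) = t})"
      using finG by (intro card_mono) (auto simp: D_def)
    also have "\<dots> \<le> (\<Sum>t\<in>D. card {i \<in> G. card (?F i W) = t})"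
      by (rule card_UN_le) (simp add: D_def)
    finally show ?thesis by (metis of_nat_le_iff of_nat_sum)
  qed
  \<comment> \<open>The ratio is at most 1/2 because \<open>\<theta> \<le> p / 2\<close>, so the
    series is at most twice its first term.\<close>
  have geo: "(\<Sum>t\<in>D. (\<theta> / p) ^ t) \<le> 2 * \<theta> / p"
  proof -
    define r where "r = \<theta> / p"
    have r: "0 \<le> r" "r \<le> 1 / 2" using \<theta> p by (auto simp: r_def field_simps)
    have "(\<Sum>t\<in>D. r ^ t) \<le> (\<Sum>t\<in>{1..card M}. r ^ t)"
      using r by (intro sum_mono2) (auto simp: D_def)
    also have "\<dots> = (\<Sum>t<card M. r * r ^ t)"
      by (rule sum.reindex_bij_witness[of _ Suc "\<lambda>t. t - 1"])
         (auto simp flip: power_Suc simp del: power_Suc)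
    also have "\<dots> = r * (\<Sum>t<card M. r ^ t)" by (simp add: sum_distrib_left)
    also have "\<dots> \<le> r * (\<Sum>t. r ^ t)"
      using r by (intro mult_left_mono sum_le_suminf summable_geometric) auto
    also have "\<dots> = r * (1 / (1 - r))" using r by (subst suminf_geometric) auto
    also have "\<dots> \<le> r * 2" using r by (intro mult_left_mono) (auto simp: field_simps)
    finally show ?thesis by (simp add: r_def mult.commute)
  qed
  have "bern_exp M p (\<lambda>W. real (card (bad W))) \<le> bern_exp M p (\<lambda>W. \<Sum>t\<in>D. real (card {i \<in> G. card (?F i W) = t}))"
    using p bad_eq by (intro bern_exp_mono) auto
  also have "\<dots> \<le> (\<Sum>t\<in>D. real (card X) * (\<theta> / p) ^ t)"
    unfolding bern_exp_sum by (intro sum_mono count)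
  also have "\<dots> \<le> real (card X) * (2 * \<theta> / p)"
    unfolding sum_distrib_left[symmetric] using geo by (intro mult_left_mono) auto
  finally have Ebad: "bern_exp M p (\<lambda>W. real (card (bad W))) \<le> real (card X) * (2 * \<theta> / p)" .
  \<comment> \<open>Markov's inequality in pointwise form: if more than a quarter of the indices are
    bad, the second summand already exceeds 1; otherwise \<open>next_round\<close> applies to the
    rest. The final loss is \<open>4 * (2 * \<theta> / p)\<close>.\<close>
  have pointwise: "bern_exp M q (\<lambda>W'. of_bool (\<not> (\<exists>i\<in>G. T i \<subseteq> W \<union> W'))) \<le> \<epsilon> + 4 / real (card X) * real (card (bad W))" for W
  proof (cases "real (card (bad W)) \<le> real (card X) / 4")
    case True
    let ?G = "G - bad W"
    have "card ?G = card G - card (bad W)" "card (bad W) \<le> card G"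
      using finG by (auto simp: bad_def intro!: card_Diff_subset card_mono)
    then have "g * real (card X) \<le> real (card ?G)"
      using True cG by (simp add: of_nat_diff algebra_simps)
    moreover have "\<forall>i\<in>?G. ?F i W \<subseteq> S i \<and> real (card (?F i W)) \<le> k'"
    proof
      fix i assume i: "i \<in> ?G"
      then obtain j where "T j \<subseteq> T i \<union> W" "?F i W = T j - W" using fragment_ex[of i G T W] by auto
      moreover have "T i \<subseteq> S i" using T i by auto
      ultimately show "?F i W \<subseteq> S i \<and> real (card (?F i W)) \<le> k'" using i by (auto simp: bad_def)
    qed
    ultimately have *: "bern_exp M q (\<lambda>W'. of_bool (\<not> (\<exists>i\<in>?G. ?F i W \<subseteq> W'))) \<le> \<epsilon>"
      using next_round[unfolded covering_failure_bound_def, rule_format, of ?G "\<lambda>i. ?F i W"] G by blast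
    have "bern_exp M q (\<lambda>W'. of_bool (\<not> (\<exists>i\<in>G. T i \<subseteq> W \<union> W'))) \<le> bern_exp M q (\<lambda>W'. of_bool (\<not> (\<exists>i\<in>?G. ?F i W \<subseteq> W')))"
    proof (rule bern_exp_mono[OF q])
      fix W'
      have "\<exists>j\<in>G. T j \<subseteq> W \<union> W'" if "i \<in> ?G" "?F i W \<subseteq> W'" for i
        using fragment_ex[of i G T W] that by blast
      then show "(of_bool (\<not> (\<exists>i\<in>G. T i \<subseteq> W \<union> W')) :: real) \<le> of_bool (\<not> (\<exists>i\<in>?G. ?F i W \<subseteq> W'))"
        by (auto simp del: bex_simps ball_simps)
    qed
    then show ?thesis using * N0 by (smt (verit) divide_nonneg_nonneg mult_nonneg_nonneg of_nat_0_le_iff)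
  next
    case False
    then have "1 \<le> 4 / real (card X) * real (card (bad W))" using N0 by (simp add: field_simps)
    moreover have "bern_exp M q (\<lambda>W'. of_bool (\<not> (\<exists>i\<in>G. T i \<subseteq> W \<union> W'))) \<le> bern_exp M q (\<lambda>W'. 1)"
      using q by (intro bern_exp_mono) auto
    ultimately show ?thesis using \<epsilon> by (simp add: bern_exp_const[OF M])
  qed
  have "bern_exp M (1 - (1 - p) * (1 - q)) (\<lambda>W. of_bool (\<not> (\<exists>i\<in>G. T i \<subseteq> W))) =
     bern_exp M p (\<lambda>W. bern_exp M q (\<lambda>W'. of_bool (\<not> (\<exists>i\<in>G. T i \<subseteq> W \<union> W'))))"
    by (rule bern_exp_union[OF M, symmetric])
  also have "\<dots> \<le> bern_exp M p (\<lambda>W. \<epsilon> + 4 / real (card X) * real (card (bad W)))"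
    using p pointwise by (intro bern_exp_mono) auto
  also have "\<dots> = \<epsilon> + 4 / real (card X) * bern_exp M p (\<lambda>W. real (card (bad W)))"
    by (simp only: bern_exp_add bern_exp_const[OF M] bern_exp_cmult)
  also have "\<dots> \<le> \<epsilon> + 4 / real (card X) * (real (card X) * (2 * \<theta> / p))"
    using Ebad by (intro add_left_mono mult_left_mono) auto
  also have "\<dots> = \<epsilon> + 8 * \<theta> / p" using N0 by simp
  finally show "bern_exp M (1 - (1 - p) * (1 - q)) (\<lambda>W. of_bool (\<not> (\<exists>i\<in>G. T i \<subseteq> W))) \<le> \<epsilon> + 8 * \<theta> / p" .
qed

text \<open>The iteration ends here: pieces with fewer than one element are empty, and a positive
  fraction \<open>g\<close> guarantees that one piece survives, so covering is certain.\<close>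

lemma covering_failure_bound_0:
  assumes "finite X" "X \<noteq> {}" "\<And>i. i \<in> X \<Longrightarrow> finite (S i)" "0 < g" "k < 1" 
  shows "covering_failure_bound M X S p k g 0"
  unfolding covering_failure_bound_def
proof (intro allI impI, elim conjE)
  fix G T
  assume G: "G \<subseteq> X" and T: "\<forall>i\<in>G. T i \<subseteq> S i \<and> real (card (T i)) \<le> k"
    and cG: "g * real (card X) \<le> real (card G)"
  have "0 < g * real (card X)" using assms by (simp add: card_gt_0_iff)
  then have "G \<noteq> {}" using cG by auto
  then obtain i where i: "i \<in> G" by auto
  have "card (T i) = 0" using T i assms(5) by (metis less_one linorder_not_less of_nat_1 of_nat_le_iff order_trans_rules(23) nless_le)
  moreover have "finite (T i)" using T i assms(3) G finite_subset by blast
  ultimately have "T i = {}" by simp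
  then have "(\<exists>i\<in>G. T i \<subseteq> W) = True" for W using i by auto
  then show "bern_exp M p (\<lambda>W. of_bool (\<not> (\<exists>i\<in>G. T i \<subseteq> W))) \<le> 0"
    by (simp add: bern_exp_def)
qed

section \<open>Permutations that preserve the edges of a forest\<close>

text \<open>An elimination order for a forest: read from the end, each pair attaches a vertex that
  has not occurred so far. The length of the list is thus the rank of its edge set.\<close>

fun peelable :: "('a \<times> 'a) list \<Rightarrow> bool" where
  "peelable [] = True"
| "peelable ((x, y) # es) = (x \<noteq> y \<and> x \<notin> fst ` set es \<union> snd ` set es \<and> peelable es)"

text \<open>Remove the first vertex \<open>x\<close>: once the image of \<open>y\<close> is known,
  \<open>x\<close> has at most \<open>d\<close> possible images instead of \<open>card V\<close>.
  Each pair thus saves a factor \<open>d / card V\<close>; the inequality is multiplied out to stay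
  in the naturals.\<close>

lemma card_hom_peelable:
  fixes nb :: "'b \<Rightarrow> 'b \<Rightarrow> bool"
  assumes "finite V" "\<And>v. v \<in> V \<Longrightarrow> card {u \<in> V. nb u v} \<le> d"
    and "peelable es" "finite U" "fst ` set es \<union> snd ` set es \<subseteq> U"
  shows "card {g \<in> U \<rightarrow>\<^sub>E V. \<forall>(x, y)\<in>set es. nb (g x) (g y)} * card V ^ length es \<le> d ^ length es * card V ^ card U"
  using assms(3-)
proof (induction es arbitrary: U)
  case Nil
  then show ?case using assms(1) by (simp add: card_PiE)
next
  case (Cons e es)
  obtain x y where e: "e = (x, y)" by (cases e)
  let ?F = "\<lambda>U es. {g \<in> U \<rightarrow>\<^sub>E V. \<forall>(x, y)\<in>set es. nb (g x) (g y)}"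
  let ?U = "U - {x}"
  have xy: "x \<noteq> y" "x \<notin> fst ` set es \<union> snd ` set es" "peelable es" using Cons.prems e by auto
  have U: "x \<in> U" "y \<in> ?U" "fst ` set es \<union> snd ` set es \<subseteq> ?U" using Cons.prems e xy by auto
  have finF: "finite (?F ?U es)" 
    by (rule finite_subset[of _ "?U \<rightarrow>\<^sub>E V"]) (use assms(1) Cons.prems in \<open>auto intro: finite_PiE\<close>)
  \<comment> \<open>A map is encoded by its restriction to \<open>U - {x}\<close> and its value at
    \<open>x\<close>; the restriction still preserves the later pairs, since \<open>x\<close> occurs
    in none of them.\<close>
  let ?h = "\<lambda>g. (restrict g ?U, g x)"
  have inj: "inj_on ?h (?F U (e # es))"
  proof (rule inj_onI)
    fix g g' assume g: "g \<in> ?F U (e # es)" "g' \<in> ?F U (e # es)" and eq: "?h g = ?h g'"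
    show "g = g'"
    proof (rule PiE_ext[of g U "\<lambda>_. V"])
      fix z assume "z \<in> U"
      then show "g z = g' z" using eq by (cases "z = x") (auto dest: fun_cong[of _ _ z])
    qed (use g in auto)
  qed
  have img: "?h ` ?F U (e # es) \<subseteq> (SIGMA g:?F ?U es. {u \<in> V. nb u (g y)})"
  proof
    fix z assume "z \<in> ?h ` ?F U (e # es)"
    then obtain g where z: "z = ?h g" and g: "g \<in> U \<rightarrow>\<^sub>E V" "nb (g x) (g y)"
      "\<forall>(x, y)\<in>set es. nb (g x) (g y)" using e by auto
    have "\<forall>(a, b)\<in>set es. nb (restrict g ?U a) (restrict g ?U b)"
    proof clarify
      fix a b assume ab: "(a, b) \<in> set es"
      then have "a \<in> ?U" "b \<in> ?U" using U(3) by force+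
      then show "nb (restrict g ?U a) (restrict g ?U b)" using g(3) ab by auto
    qed
    moreover have "restrict g ?U \<in> ?U \<rightarrow>\<^sub>E V" "g x \<in> V" "nb (g x) (restrict g ?U y)"
      using g U by auto
    ultimately show "z \<in> (SIGMA g:?F ?U es. {u \<in> V. nb u (g y)})"
      unfolding z by blast
  qed
  have "card (?F U (e # es)) \<le> card (SIGMA g:?F ?U es. {u \<in> V. nb u (g y)})"
    by (rule card_inj_on_le[OF inj img]) (use finF assms(1) in \<open>auto intro!: finite_SigmaI\<close>)
  also have "\<dots> = (\<Sum>g\<in>?F ?U es. card {u \<in> V. nb u (g y)})"
    using finF assms(1) by (intro card_SigmaI) auto
  also have "\<dots> \<le> (\<Sum>g\<in>?F ?U es. d)"
    using U by (intro sum_mono assms(2)) auto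
  finally have "card (?F U (e # es)) \<le> d * card (?F ?U es)" by (simp add: mult.commute)
  then have "card (?F U (e # es)) * card V ^ length (e # es) \<le> d * card (?F ?U es) * card V ^ length (e # es)"
    by (rule mult_right_mono) simp
  also have "\<dots> = d * card V * (card (?F ?U es) * card V ^ length es)" by simp
  also have "\<dots> \<le> d * card V * (d ^ length es * card V ^ card ?U)"
    using Cons.IH[of ?U] xy U Cons.prems by (intro mult_left_mono) auto
  also have "\<dots> = d ^ length (e # es) * card V ^ Suc (card ?U)" by simp
  also have "Suc (card ?U) = card U" using U(1) Cons.prems by (metis card_Suc_Diff1)
  finally show ?case .
qed

text \<open>Composition with \<open>\<tau>\<close> translates the permutations that fix
  \<open>U\<close> pointwise, which are those of the complement.\<close>

lemma card_permutes_agreeing: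
  assumes "finite V" "U \<subseteq> V" "\<tau> permutes V"
  shows "card {\<sigma>. \<sigma> permutes V \<and> (\<forall>x\<in>U. \<sigma> x = \<tau> x)} = fact (card V - card U)"
proof -
  have "bij_betw (\<lambda>\<rho>. \<tau> \<circ> \<rho>) {\<rho>. \<rho> permutes (V - U)} {\<sigma>. \<sigma> permutes V \<and> (\<forall>x\<in>U. \<sigma> x = \<tau> x)}"
  proof (rule bij_betw_byWitness[where f' = "\<lambda>\<sigma>. inv \<tau> \<circ> \<sigma>"])
    show "\<forall>\<rho>\<in>{\<rho>. \<rho> permutes (V - U)}. inv \<tau> \<circ> (\<tau> \<circ> \<rho>) = \<rho>"
      using permutes_inv_o(2)[OF assms(3)] by (simp add: o_assoc)
    show "\<forall>\<sigma>\<in>{\<sigma>. \<sigma> permutes V \<and> (\<forall>x\<in>U. \<sigma> x = \<tau> x)}. \<tau> \<circ> (inv \<tau> \<circ> \<sigma>) = \<sigma>"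
      using permutes_inv_o(1)[OF assms(3)] by (simp add: o_assoc)
    show "(\<lambda>\<rho>. \<tau> \<circ> \<rho>) ` {\<rho>. \<rho> permutes (V - U)} \<subseteq> {\<sigma>. \<sigma> permutes V \<and> (\<forall>x\<in>U. \<sigma> x = \<tau> x)}"
    proof clarify
      fix \<rho> assume r: "\<rho> permutes (V - U)"
      then have "\<rho> permutes V" by (rule permutes_subset) auto
      moreover have "\<forall>x\<in>U. \<rho> x = x" using r by (auto simp: permutes_def)
      ultimately show "(\<tau> \<circ> \<rho>) permutes V \<and> (\<forall>x\<in>U. (\<tau> \<circ> \<rho>) x = \<tau> x)"
        using assms(3) by (auto intro: permutes_compose)
    qed
    show "(\<lambda>\<sigma>. inv \<tau> \<circ> \<sigma>) ` {\<sigma>. \<sigma> permutes V \<and> (\<forall>x\<in>U. \<sigma> x = \<tau> x)} \<subseteq> {\<rho>. \<rho> permutes (V - U)}"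
    proof clarify
      fix \<sigma> assume s: "\<sigma> permutes V" "\<forall>x\<in>U. \<sigma> x = \<tau> x"
      have "(inv \<tau> \<circ> \<sigma>) permutes V" using s assms(3) by (intro permutes_compose permutes_inv)
      then show "(inv \<tau> \<circ> \<sigma>) permutes (V - U)"
        by (rule permutes_superset) (use s permutes_inverses(2)[OF assms(3)] in auto)
    qed
  qed
  then have "card {\<sigma>. \<sigma> permutes V \<and> (\<forall>x\<in>U. \<sigma> x = \<tau> x)} = card {\<rho>. \<rho> permutes (V - U)}"
    by (simp add: bij_betw_same_card)
  also have "\<dots> = fact (card (V - U))" using assms by (intro card_permutations) auto
  finally show ?thesis using assms by (simp add: card_Diff_subset finite_subset)
qed

text \<open>One term of the exponential series gives \<open>v ^ v \<le> exp v * fact v\<close>, and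
  \<open>n choose v\<close> is at least \<open>(n / v) ^ v\<close>. The result is the price of
  counting all maps on \<open>v\<close> points instead of the injective ones.\<close>

lemma fact_diff_mult_pow_le:
  assumes "v \<le> n"
  shows "fact (n - v) * real n ^ v \<le> exp (real v) * fact n"
proof (cases "v = 0")
  case False
  have "(\<Sum>k\<in>{v}. real v ^ k /\<^sub>R fact k) \<le> exp (real v)"
    unfolding exp_def using summable_exp_generic[of "real v"]
    by (intro sum_le_suminf) auto
  then have 1: "real v ^ v \<le> exp (real v) * fact v"
    by (simp add: field_simps)
  have "(real n / real v) ^ v \<le> real (n choose v)"
    using binomial_ge_n_over_k_pow_k[OF assms, where 'a = real] by simp
  then have 2: "real n ^ v \<le> real (n choose v) * real v ^ v"
    using False by (simp add: power_divide field_simps)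
  have "fact (n - v) * real n ^ v \<le> fact (n - v) * (real (n choose v) * (exp (real v) * fact v))"
    using 2 mult_left_mono[OF 1, of "real (n choose v)"] by (intro mult_left_mono) auto
  also have "\<dots> = exp (real v) * (fact v * fact (n - v) * real (n choose v))" by simp
  also have "fact v * fact (n - v) * real (n choose v) = fact n"
    using arg_cong[OF binomial_fact_lemma[OF assms], of real] by (simp only: of_nat_fact of_nat_mult)
  finally show ?thesis .
qed simp

text \<open>Group the permutations by their restriction to \<open>U\<close>. The restrictions are
  among the maps of \<open>card_hom_peelable\<close>, and each extends in at most
  \<open>fact (card V - card U)\<close> ways; forgetting injectivity on \<open>U\<close> costs
  \<open>exp (card U)\<close>.\<close>

lemma card_permutes_peelable_le:
  fixes nb :: "'a \<Rightarrow> 'a \<Rightarrow> bool"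
  assumes "finite V" "\<And>v. v \<in> V \<Longrightarrow> card {u \<in> V. nb u v} \<le> d"
    and "peelable es" "fst ` set es \<union> snd ` set es \<subseteq> U" "U \<subseteq> V" "V \<noteq> {}"
  shows "real (card {\<sigma>. \<sigma> permutes V \<and> (\<forall>(x, y)\<in>set es. nb (\<sigma> x) (\<sigma> y))}) \<le>
    fact (card V) * exp (real (card U)) * (real d / real (card V)) ^ length es"
proof -
  let ?A = "{\<sigma>. \<sigma> permutes V \<and> (\<forall>(x, y)\<in>set es. nb (\<sigma> x) (\<sigma> y))}"
  let ?B = "{g \<in> U \<rightarrow>\<^sub>E V. \<forall>(x, y)\<in>set es. nb (g x) (g y)}"
  have finU: "finite U" using assms finite_subset by blast
  have finA: "finite ?A" using finite_permutations[OF assms(1)] by (rule rev_finite_subset) auto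
  have finB: "finite ?B" by (rule finite_subset[of _ "U \<rightarrow>\<^sub>E V"]) (use finU assms(1) in \<open>auto intro: finite_PiE\<close>)
  let ?r = "\<lambda>\<sigma>. restrict \<sigma> U"
  have img: "?r ` ?A \<subseteq> ?B"
  proof clarify
    fix \<sigma> assume s: "\<sigma> permutes V" "\<forall>(x, y)\<in>set es. nb (\<sigma> x) (\<sigma> y)"
    have "\<sigma> z \<in> V" if "z \<in> U" for z using s(1) that assms(5) by (metis permutes_in_image subsetD)
    then have "restrict \<sigma> U \<in> U \<rightarrow>\<^sub>E V" by auto
    moreover have "\<forall>(a, b)\<in>set es. nb (restrict \<sigma> U a) (restrict \<sigma> U b)"
    proof clarify
      fix a b assume ab: "(a, b) \<in> set es"
      then have "a \<in> U" "b \<in> U" using assms(4) by force+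
      then show "nb (restrict \<sigma> U a) (restrict \<sigma> U b)" using s(2) ab by auto
    qed
    ultimately show "restrict \<sigma> U \<in> U \<rightarrow>\<^sub>E V \<and> (\<forall>(x, y)\<in>set es. nb (restrict \<sigma> U x) (restrict \<sigma> U y))"
      by blast
  qed
  have "card ?A = (\<Sum>g\<in>?B. card {\<sigma> \<in> ?A. ?r \<sigma> = g})"
    using sum.group[OF finA finB img, of "\<lambda>_. 1 :: nat"] by simp
  also have "\<dots> \<le> (\<Sum>g\<in>?B. fact (card V - card U))"
  proof (rule sum_mono)
    fix g
    show "card {\<sigma> \<in> ?A. ?r \<sigma> = g} \<le> fact (card V - card U)"
    proof (cases "{\<sigma> \<in> ?A. ?r \<sigma> = g} = {}")
      case False
      then obtain \<tau> where t: "\<tau> permutes V" "?r \<tau> = g" by auto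
      have "{\<sigma> \<in> ?A. ?r \<sigma> = g} \<subseteq> {\<sigma>. \<sigma> permutes V \<and> (\<forall>x\<in>U. \<sigma> x = \<tau> x)}"
        using t by (auto simp: fun_eq_iff restrict_def split: if_splits)
      then have "card {\<sigma> \<in> ?A. ?r \<sigma> = g} \<le> card {\<sigma>. \<sigma> permutes V \<and> (\<forall>x\<in>U. \<sigma> x = \<tau> x)}"
        using finite_permutations[OF assms(1)] by (intro card_mono) (auto intro: rev_finite_subset)
      then show ?thesis using card_permutes_agreeing[OF assms(1,5) t(1)] by simp
    next
      case True
      then show ?thesis by (simp only: card.empty)
    qed
  qed
  finally have A: "card ?A \<le> card ?B * fact (card V - card U)" by simp
  have V0: "real (card V) > 0" using assms by (simp add: card_gt_0_iff)
  have "card ?B * card V ^ length es \<le> d ^ length es * card V ^ card U"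
    using card_hom_peelable[of V nb d es U, OF assms(1-3) finU assms(4)] .
  then have "real (card ?B) * real (card V) ^ length es \<le> real d ^ length es * real (card V) ^ card U"
    by (simp only: of_nat_le_iff flip: of_nat_mult of_nat_power)
  then have B: "real (card ?B) \<le> (real d / real (card V)) ^ length es * real (card V) ^ card U"
    using V0 by (simp add: power_divide field_simps)
  have "real (card ?A) \<le> real (card ?B * fact (card V - card U))"
    using A by (simp only: of_nat_le_iff)
  also have "\<dots> = real (card ?B) * fact (card V - card U)"
    by (simp only: of_nat_mult of_nat_fact)
  also have "\<dots> \<le> (real d / real (card V)) ^ length es * real (card V) ^ card U * fact (card V - card U)"
    using B by (intro mult_right_mono) auto
  also have "\<dots> = (real d / real (card V)) ^ length es * (fact (card V - card U) * real (card V) ^ card U)"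
    by simp
  also have "\<dots> \<le> (real d / real (card V)) ^ length es * (exp (real (card U)) * fact (card V))"
    using fact_diff_mult_pow_le[of "card U" "card V"] assms card_mono by (intro mult_left_mono) auto
  finally show ?thesis by (simp add: mult_ac)
qed

section \<open>Forests in sets of ladder edges\<close>

text \<open>Rungs are numbered from 0. With the reduction modulo \<open>m\<close> built in, a window
  of consecutive cells may run past \<open>m\<close> without separate wrap-around cases.\<close>

definition ladder_top :: "nat \<Rightarrow> nat \<Rightarrow> nat" where
  "ladder_top m j = 2 * (j mod m) + 1"

definition ladder_bot :: "nat \<Rightarrow> nat \<Rightarrow> nat" where
  "ladder_bot m j = 2 * (j mod m) + 2"

text \<open>The edges of \<open>C4e (2 * m)\<close> are grouped into \<open>m\<close> cells; cell \<open>j\<close> consists of the rung \<open>j\<close> and of the two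
  edges that join rung \<open>j\<close> to rung \<open>j + 1\<close>.\<close>

definition ladder_edge :: "nat \<Rightarrow> nat \<times> nat \<Rightarrow> nat set" where
  "ladder_edge m = (\<lambda>(j, s).
     if s = 0 then {ladder_top m j, ladder_bot m j}
     else if s = 1 then {ladder_top m j, ladder_top m (Suc j)}
     else {ladder_bot m j, ladder_bot m (Suc j)})"

lemma C4e_edges: "snd (C4e (2 * m)) = ladder_edge m ` ({..<m} \<times> {..<3})"
proof -
  have split: "{..<m} \<times> {..<3::nat} = (\<lambda>j. (j, 0)) ` {..<m} \<union> (\<lambda>j. (j, 1)) ` {..<m} \<union> (\<lambda>j. (j, 2)) ` {..<m}"
    by (auto simp: less_Suc_eq numeral_3_eq_3)
  have shift: "{1..m} = Suc ` {..<m}" by (simp add: lessThan_atLeast0 image_Suc_atLeastLessThan atLeastLessThanSuc_atLeastAtMost)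
  have "(\<lambda>i. {2 * i - 1, 2 * i}) ` {1..m} = (\<lambda>j. ladder_edge m (j, 0)) ` {..<m}"
    unfolding shift image_image
    by (intro image_cong refl) (simp add: ladder_edge_def ladder_top_def ladder_bot_def)
  moreover have "cycle_edges (\<lambda>i. 2 * i - 1) m = (\<lambda>j. ladder_edge m (j, 1)) ` {..<m}"
    unfolding cycle_edges_def shift image_image
    by (intro image_cong refl) (simp add: ladder_edge_def ladder_top_def)
  moreover have "cycle_edges (\<lambda>i. 2 * i) m = (\<lambda>j. ladder_edge m (j, 2)) ` {..<m}"
    unfolding cycle_edges_def shift image_image
    by (intro image_cong refl) (simp add: ladder_edge_def ladder_bot_def)
  ultimately show ?thesis
    unfolding split image_Un image_image by (simp add: C4e_def)
qed

lemma ladder_vertices_neq [simp]: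
  "ladder_top m i \<noteq> ladder_bot m j" "ladder_bot m i \<noteq> ladder_top m j"
proof -
  have "odd (ladder_top m i)" "even (ladder_bot m i)" for i
    by (simp_all add: ladder_top_def ladder_bot_def)
  then show "ladder_top m i \<noteq> ladder_bot m j" "ladder_bot m i \<noteq> ladder_top m j" by metis+
qed

lemma ladder_vertices_eq_iff [simp]:
  "ladder_top m i = ladder_top m j \<longleftrightarrow> i mod m = j mod m"
  "ladder_bot m i = ladder_bot m j \<longleftrightarrow> i mod m = j mod m"
  by (auto simp: ladder_top_def ladder_bot_def)

lemma mod_neq_in_window:
  assumes "i < i'" "i' < i + m"
  shows "i mod m \<noteq> i' mod (m::nat)"
proof
  assume "i mod m = i' mod m"
  then have "m dvd i' - i" using assms by (metis mod_eq_dvd_iff_nat nat_less_le)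
  then show False using assms dvd_imp_le[of m "i' - i"] by linarith
qed

text \<open>Each listed pair starts with a vertex that occurs in no later pair, here or in the lists of the following
  cells. A full cell contributes its third edge only if the next cell is empty; otherwise it may close a cycle.\<close>

definition cell_forest :: "nat \<Rightarrow> (nat \<times> nat) set \<Rightarrow> nat \<Rightarrow> (nat \<times> nat) list" where
  "cell_forest m J j =
    (let a = ladder_top m j; b = ladder_bot m j; a' = ladder_top m (Suc j); b' = ladder_bot m (Suc j);
         P = (\<lambda>s. (j mod m, s) \<in> J)
     in if P 0 \<and> P 1 \<and> P 2 then
          (if \<forall>s. (Suc j mod m, s) \<notin> J then [(b', b), (b, a), (a, a')] else [(b, a), (a, a')])
        else if P 0 \<and> P 1 then [(b, a), (a, a')]
        else if P 0 \<and> P 2 then [(a, b), (b, b')]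
        else if P 1 \<and> P 2 then [(a, a'), (b, b')]
        else if P 0 then [(a, b)]
        else if P 1 then [(a, a')]
        else if P 2 then [(b, b')]
        else [])"

fun strip_forest :: "nat \<Rightarrow> (nat \<times> nat) set \<Rightarrow> nat \<Rightarrow> nat \<Rightarrow> (nat \<times> nat) list" where
  "strip_forest m J j 0 = []"
| "strip_forest m J j (Suc l) = cell_forest m J j @ strip_forest m J (Suc j) l"

abbreviation ends_of :: "('a \<times> 'a) list \<Rightarrow> 'a set" where
  "ends_of es \<equiv> fst ` set es \<union> snd ` set es"

lemma cell_forest_ends:
  "ends_of (cell_forest m J j) \<subseteq> {ladder_top m j, ladder_bot m j, ladder_top m (Suc j), ladder_bot m (Suc j)}"
  by (auto simp: cell_forest_def Let_def split: if_splits)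

lemma cell_forest_empty: "\<forall>s. (j mod m, s) \<notin> J \<Longrightarrow> cell_forest m J j = []"
  by (simp add: cell_forest_def)

lemma strip_forest_ends:
  "ends_of (strip_forest m J j l) \<subseteq> (\<Union>i\<in>{j..j + l}. {ladder_top m i, ladder_bot m i})"
proof (induction l arbitrary: j)
  case (Suc l)
  have "ends_of (strip_forest m J j (Suc l)) = ends_of (cell_forest m J j) \<union> ends_of (strip_forest m J (Suc j) l)"
    by auto
  also have "\<dots> \<subseteq> {ladder_top m j, ladder_bot m j, ladder_top m (Suc j), ladder_bot m (Suc j)} \<union>
     (\<Union>i\<in>{Suc j..Suc j + l}. {ladder_top m i, ladder_bot m i})"
    by (rule Un_mono[OF cell_forest_ends Suc.IH])
  also have "\<dots> \<subseteq> (\<Union>i\<in>{j..j + Suc l}. {ladder_top m i, ladder_bot m i})"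
  proof -
    have "j \<in> {j..j + Suc l}" "Suc j \<in> {j..j + Suc l}" "{Suc j..Suc j + l} \<subseteq> {j..j + Suc l}" by auto
    then show ?thesis by blast
  qed
  finally show ?case .
qed simp

text \<open>If the first cell is empty, the first rung of the strip is not touched at all. This
  frees the vertex used by the third edge of a full cell just before it.\<close>

lemma strip_forest_ends_empty:
  assumes "\<forall>s. (j mod m, s) \<notin> J"
  shows "ends_of (strip_forest m J j l) \<subseteq> (\<Union>i\<in>{Suc j..j + l}. {ladder_top m i, ladder_bot m i})"
  using strip_forest_ends[of m J "Suc j" "l - 1"] assms by (cases l) (simp_all add: cell_forest_empty)

text \<open>The strip touches the rungs \<open>j\<close> to \<open>j + l\<close>, which are distinct
  because \<open>l < m\<close>. So the vertices of rung \<open>j\<close> never return in later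
  cells.\<close>

lemma peelable_strip_forest:
  assumes "l < m"
  shows "peelable (strip_forest m J j l)"
  using assms
proof (induction l arbitrary: j)
  case (Suc l)
  let ?R = "strip_forest m J (Suc j) l"
  have IH: "peelable ?R" using Suc by simp
  have mod: "j mod m \<noteq> i mod m" if "i \<in> {Suc j..Suc j + l}" for i
    using that Suc.prems by (intro mod_neq_in_window) auto
  have mod2: "Suc j mod m \<noteq> i mod m" if "i \<in> {Suc (Suc j)..Suc j + l}" for i
    using that Suc.prems by (intro mod_neq_in_window) auto
  have "\<exists>i\<in>{Suc j..Suc j + l}. x = ladder_top m i \<or> x = ladder_bot m i" if "x \<in> ends_of ?R" for x
    using strip_forest_ends[of m J "Suc j" l] that by blast
  then have R: "ladder_top m j \<notin> ends_of ?R" "ladder_bot m j \<notin> ends_of ?R"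
    using mod by (metis ladder_vertices_eq_iff ladder_vertices_neq)+
  \<comment> \<open>Only the third edge of a full cell starts on rung \<open>Suc j\<close>; it is
    listed only when the next cell is empty, and then this vertex does not occur later.\<close>
  have R2: "ladder_bot m (Suc j) \<notin> ends_of ?R" if e: "\<forall>s. (Suc j mod m, s) \<notin> J"
  proof
    assume "ladder_bot m (Suc j) \<in> ends_of ?R"
    then obtain i where "i \<in> {Suc (Suc j)..Suc j + l}" "ladder_bot m (Suc j) \<in> {ladder_top m i, ladder_bot m i}"
      using strip_forest_ends_empty[OF e, of l] by blast
    then show False using mod2 by auto
  qed
  have jj: "j mod m \<noteq> Suc j mod m" using Suc.prems by (intro mod_neq_in_window) auto
  show ?case
  proof (cases "\<forall>s. (Suc j mod m, s) \<notin> J")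
    case True
    then show ?thesis
      using IH R R2[OF True] jj jj[symmetric] by (simp add: cell_forest_def Let_def)
  next
    case False
    then have "(\<forall>s. (Suc j mod m, s) \<notin> J) = False" by simp
    then show ?thesis
      using IH R jj jj[symmetric] by (simp only: cell_forest_def Let_def strip_forest.simps) simp
  qed
qed simp

lemma strip_forest_edges:
  assumes "(x, y) \<in> set (strip_forest m J j l)" "0 < m"
  shows "{x, y} \<in> ladder_edge m ` J"
  using assms
proof (induction l arbitrary: j)
  case (Suc l)
  show ?case
  proof (cases "(x, y) \<in> set (cell_forest m J j)")
    case True
    have eqs: "ladder_edge m (j mod m, 0) = {ladder_top m j, ladder_bot m j}"
      "ladder_edge m (j mod m, 1) = {ladder_top m j, ladder_top m (Suc j)}"
      "ladder_edge m (j mod m, 2) = {ladder_bot m j, ladder_bot m (Suc j)}"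
      by (simp_all add: ladder_edge_def ladder_top_def ladder_bot_def mod_Suc_eq)
    have "(j mod m, 0) \<in> J \<and> {x, y} = {ladder_top m j, ladder_bot m j} \<or>
      (j mod m, 1) \<in> J \<and> {x, y} = {ladder_top m j, ladder_top m (Suc j)} \<or>
      (j mod m, 2) \<in> J \<and> {x, y} = {ladder_bot m j, ladder_bot m (Suc j)}"
      using True unfolding cell_forest_def Let_def doubleton_eq_iff
      by (simp split: if_splits del: ladder_vertices_eq_iff; blast)
    then have "\<exists>s. (j mod m, s) \<in> J \<and> {x, y} = ladder_edge m (j mod m, s)"
      unfolding eqs[symmetric] by blast
    then show ?thesis by blast
  qed (use Suc in auto)
qed simp

text \<open>The local source of the exponent 2/3. One or two edges all enter the forest, leaving
  room for the end term: 3 \<le> 3 and 5 \<le> 6. A full cell has two forest edges if the next cell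
  is nonempty (6 \<le> 6) and three otherwise (7 \<le> 9).\<close>

lemma cell_forest_length:
  fixes j m :: nat
  assumes "J \<subseteq> UNIV \<times> {..<3}"
  defines "c \<equiv> card {s. (j mod m, s) \<in> J}"
  shows "2 * c + of_bool (c \<noteq> 0 \<and> (\<forall>s. (Suc j mod m, s) \<notin> J)) \<le> 3 * length (cell_forest m J j)"
    and "length (cell_forest m J j) \<le> c"
proof -
  let ?P = "\<lambda>s. (j mod m, s) \<in> J"
  have "c = card ({..<3} \<inter> {s. ?P s})" unfolding c_def using assms(1) by (intro arg_cong[of _ _ card]) auto
  also have "\<dots> = (\<Sum>s<3. of_bool (?P s))" by simp
  also have "\<dots> = of_bool (?P 0) + of_bool (?P 1) + of_bool (?P 2)"
    by (simp add: eval_nat_numeral lessThan_Suc del: sum_of_bool_eq)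
  finally have "c = of_bool (?P 0) + of_bool (?P 1) + of_bool (?P 2)" .
  then show "2 * c + of_bool (c \<noteq> 0 \<and> (\<forall>s. (Suc j mod m, s) \<notin> J)) \<le> 3 * length (cell_forest m J j)"
    and "length (cell_forest m J j) \<le> c"
    by (auto simp: cell_forest_def Let_def)
qed

lemma strip_forest_length:
  fixes m :: nat
  assumes "J \<subseteq> UNIV \<times> {..<3}"
  defines "c \<equiv> \<lambda>j. card {s. (j mod m, s) \<in> J}"
  shows "(\<Sum>i\<in>{j..<j + l}. 2 * c i + of_bool (c i \<noteq> 0 \<and> (\<forall>s. (Suc i mod m, s) \<notin> J))) \<le> 3 * length (strip_forest m J j l)"
    and "length (strip_forest m J j l) \<le> (\<Sum>i\<in>{j..<j + l}. c i)"
proof (induction l arbitrary: j)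
  case (Suc l)
  have eq: "{j..<j + Suc l} = insert j {Suc j..<Suc j + l}" for j by auto
  {
    case 1
    show ?case using cell_forest_length(1)[OF assms(1), of j m] Suc(1)[of "Suc j"]
      unfolding eq by (subst sum.insert) (simp_all add: c_def)
  next
    case 2
    show ?case using cell_forest_length(2)[OF assms(1), of m j] Suc(2)[of "Suc j"]
      unfolding eq by (subst sum.insert) (simp_all add: c_def)
  }
qed simp_all

lemma sum_mod_window:
  fixes f :: "nat \<Rightarrow> 'a::comm_monoid_add"
  shows "(\<Sum>i\<in>{s..<s + m}. f (i mod m)) = (\<Sum>i<m. f i)"
proof (induction s)
  case 0
  show ?case by (simp add: lessThan_atLeast0)
next
  case (Suc s)
  show ?case
  proof (cases "m = 0")
    case False
    then have "{s..<s + m} = insert s {Suc s..<s + m}" "{Suc s..<Suc s + m} = insert (s + m) {Suc s..<s + m}" by auto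
    then show ?thesis using Suc by simp
  qed simp
qed

text \<open>For \<open>D\<close> below \<open>m\<close> these are the last cells of the maximal
  cyclic intervals of \<open>D\<close>, so their number counts the intervals, except that the full
  cycle has no end.\<close>

definition cyc_ends :: "nat \<Rightarrow> nat set \<Rightarrow> nat set" where
  "cyc_ends m D = {j \<in> D. Suc j mod m \<notin> D}"

text \<open>The cycle of cells is cut at an empty cell. If there is none, then one cell is sacrificed, which costs the summand 6.\<close>

lemma ladder_forest_exists:
  assumes J: "J \<subseteq> {..<m} \<times> {..<3}" and m: "0 < m"
  shows "\<exists>es. peelable es \<and> (\<forall>(x, y)\<in>set es. {x, y} \<in> ladder_edge m ` J) \<and> length es \<le> card J \<and>
     2 * card J + card (cyc_ends m (fst ` J)) \<le> 3 * length es + (if fst ` J = {..<m} then 6 else 0)"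
proof -
  have finJ: "finite J" using J finite_subset by (metis finite_SigmaI finite_lessThan)
  have J3: "J \<subseteq> UNIV \<times> {..<3}" using J by auto
  define c where "c j = card {s. (j, s) \<in> J}" for j
  define f where "f j = 2 * c j + of_bool (c j \<noteq> 0 \<and> (\<forall>s. (Suc j mod m, s) \<notin> J))" for j
  have fin_c: "finite {s. (j, s) \<in> J}" for j
    by (rule finite_subset[of _ "{..<3}"]) (use J in auto)
  have c0: "c j \<noteq> 0 \<longleftrightarrow> j \<in> fst ` J" for j
    using fin_c by (force simp: c_def card_eq_0_iff)
  have J_eq: "J = (SIGMA j:{..<m}. {s. (j, s) \<in> J})" using J by auto
  have sum_c: "(\<Sum>j<m. c j) = card J"
    unfolding c_def by (subst (2) J_eq, subst card_SigmaI) (use fin_c in auto)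
  have "(\<Sum>j<m. (of_bool (c j \<noteq> 0 \<and> (\<forall>s. (Suc j mod m, s) \<notin> J)) :: nat)) = card (cyc_ends m (fst ` J))"
  proof -
    have "cyc_ends m (fst ` J) = {j \<in> {..<m}. c j \<noteq> 0 \<and> (\<forall>s. (Suc j mod m, s) \<notin> J)}"
      unfolding cyc_ends_def c0 using J by (force simp: image_iff)
    then show ?thesis by (simp add: Int_def conj_commute)
  qed
  then have sum_f: "(\<Sum>j<m. f j) = 2 * card J + card (cyc_ends m (fst ` J))"
    unfolding f_def sum.distrib by (simp add: sum_distrib_left[symmetric] sum_c)
  \<comment> \<open>The cell at which the cycle is cut: an empty one if possible, otherwise cell
    0.\<close>
  define s where "s = (if fst ` J = {..<m} then 0 else (SOME j. j < m \<and> j \<notin> fst ` J))"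
  have s: "s < m \<and> (fst ` J \<noteq> {..<m} \<longrightarrow> s \<notin> fst ` J)"
  proof (cases "fst ` J = {..<m}")
    case False
    then have "\<exists>j. j < m \<and> j \<notin> fst ` J" using J by auto
    from someI_ex[OF this] show ?thesis using False by (simp add: s_def)
  qed (use m in \<open>simp add: s_def\<close>)
  \<comment> \<open>Only the \<open>m - 1\<close> cells after \<open>s\<close> are used, as
    \<open>peelable_strip_forest\<close> asks for fewer than \<open>m\<close>.\<close>
  let ?es = "strip_forest m J (Suc s) (m - 1)"
  have win: "{s..<s + m} = insert s {Suc s..<Suc s + (m - 1)}" using m by auto
  have smod: "s mod m = s" using s by simp
  \<comment> \<open>If all cells are nonempty, the lost cell has at most three edges and is not an
    end, so it weighs at most \<open>2 * 3\<close>.\<close>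
  have fs: "f s \<le> (if fst ` J = {..<m} then 6 else 0)"
  proof (cases "fst ` J = {..<m}")
    case True
    have "c s \<le> card {..<3::nat}" unfolding c_def using J by (intro card_mono) auto
    moreover have "Suc s mod m \<in> fst ` J" using True m by simp
    then have "\<not> (\<forall>r. (Suc s mod m, r) \<notin> J)" by force
    ultimately show ?thesis using True by (auto simp: f_def)
  next
    case False
    then have "c s = 0" using s c0 by blast
    then show ?thesis by (simp add: f_def)
  qed
  have modSuc: "Suc (i mod m) mod m = Suc i mod m" for i by (rule mod_Suc_eq)
  have "(\<Sum>i\<in>{Suc s..<Suc s + (m - 1)}. f (i mod m)) \<le> 3 * length ?es"
    using strip_forest_length(1)[OF J3, where m = m and j = "Suc s" and l = "m - 1"] unfolding f_def c_def modSuc .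
  moreover have "(\<Sum>j<m. f j) = f s + (\<Sum>i\<in>{Suc s..<Suc s + (m - 1)}. f (i mod m))"
    using sum_mod_window[of f m s] unfolding win by (subst (asm) sum.insert) (auto simp: smod)
  ultimately have len: "2 * card J + card (cyc_ends m (fst ` J)) \<le> 3 * length ?es + (if fst ` J = {..<m} then 6 else 0)"
    using sum_f fs by linarith
  have "length ?es \<le> (\<Sum>i\<in>{Suc s..<Suc s + (m - 1)}. c (i mod m))"
    using strip_forest_length(2)[OF J3, where m = m and j = "Suc s" and l = "m - 1"] unfolding c_def .
  also have "\<dots> \<le> card J"
    using sum_mod_window[of c m s] unfolding win sum_c by (subst (asm) sum.insert) auto
  finally have "length ?es \<le> card J" .
  moreover have "peelable ?es" using m by (intro peelable_strip_forest) simp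
  moreover have "\<forall>(x, y)\<in>set ?es. {x, y} \<in> ladder_edge m ` J" using strip_forest_edges m by blast
  ultimately show ?thesis using len by blast
qed

text \<open>The candidates are the other end of the rung and the two neighbours along the same side.
  This is the bound \<open>d = 3\<close> in the forest count.\<close>

lemma ladder_degree:
  assumes "0 < m"
  shows "card {u \<in> V. {u, v} \<in> ladder_edge m ` ({..<m} \<times> {..<3})} \<le> 3"
proof -
  \<comment> \<open>The cyclic predecessor is written with \<open>m - 1\<close> to avoid truncated
    subtraction at 0.\<close>
  have pred: "j = (i + (m - 1)) mod m" if "Suc j mod m = i mod m" "j < m" for i j
  proof -
    have "(i + (m - 1)) mod m = (Suc j + (m - 1)) mod m" using that by (metis mod_add_left_eq)
    also have "\<dots> = j" using that(2) by simp
    finally show ?thesis by simp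
  qed
  have "\<exists>A. card A \<le> 3 \<and> finite A \<and> {u \<in> V. {u, v} \<in> ladder_edge m ` ({..<m} \<times> {..<3})} \<subseteq> A"
  proof (cases "{u \<in> V. {u, v} \<in> ladder_edge m ` ({..<m} \<times> {..<3})} = {}")
    case True
    then show ?thesis by (intro exI[of _ "{}"]) auto
  next
    case False
    then obtain i where i: "v = ladder_top m i \<or> v = ladder_bot m i"
      by (auto simp: ladder_edge_def doubleton_eq_iff simp del: ladder_vertices_eq_iff split: if_splits)
    from i show ?thesis
    proof
      assume v: "v = ladder_top m i"
      have "{u \<in> V. {u, v} \<in> ladder_edge m ` ({..<m} \<times> {..<3})} \<subseteq>
         {ladder_bot m i, ladder_top m (Suc i), ladder_top m ((i + (m - 1)) mod m)}"
        using pred by (auto simp: v ladder_edge_def doubleton_eq_iff split: if_splits)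
           (metis mod_Suc_eq mod_less mod_mod_trivial)+
      then show ?thesis by (intro exI[of _ "{ladder_bot m i, ladder_top m (Suc i), ladder_top m ((i + (m - 1)) mod m)}"])
         (auto simp: card_insert_if)
    next
      assume v: "v = ladder_bot m i"
      have "{u \<in> V. {u, v} \<in> ladder_edge m ` ({..<m} \<times> {..<3})} \<subseteq>
         {ladder_top m i, ladder_bot m (Suc i), ladder_bot m ((i + (m - 1)) mod m)}"
        using pred by (auto simp: v ladder_edge_def doubleton_eq_iff split: if_splits)
           (metis mod_Suc_eq mod_less mod_mod_trivial)+
      then show ?thesis by (intro exI[of _ "{ladder_top m i, ladder_bot m (Suc i), ladder_bot m ((i + (m - 1)) mod m)}"])
         (auto simp: card_insert_if)
    qed
  qed
  then show ?thesis by (meson card_mono order_trans)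
qed

section \<open>Sets of cells with prescribed interval ends\<close>

lemma cyc_ends_empty_imp_full:
  assumes "D \<subseteq> {..<m}" "D \<noteq> {}" "cyc_ends m D = {}"
  shows "D = {..<m}"
proof -
  obtain x where x: "x \<in> D" using assms by auto
  have step: "Suc j mod m \<in> D" if "j \<in> D" for j using assms(3) that by (auto simp: cyc_ends_def)
  have it: "(x + k) mod m \<in> D" for k
  proof (induction k)
    case 0
    show ?case using x assms(1) by auto
  next
    case (Suc k)
    then show ?case using step[of "(x + k) mod m"] by (simp add: mod_Suc_eq)
  qed
  have "y \<in> D" if "y < m" for y
  proof -
    have "x < m" using x assms(1) by auto
    then have "(x + (m - x + y)) mod m = y" using that by simp
    then show ?thesis using it[of "m - x + y"] by simp
  qed
  then show ?thesis using assms(1) by auto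
qed

text \<open>Deleting an end \<open>e\<close> from \<open>D\<close> either just removes \<open>e\<close> from the set of ends or replaces it there by its predecessor.\<close>

lemma card_fixed_cyc_ends_le:
  "card {D. D \<subseteq> {..<m} \<and> card D = d \<and> cyc_ends m D = E} \<le> 2 ^ d"
proof (induction d arbitrary: E)
  case 0
  have "{D. D \<subseteq> {..<m} \<and> card D = 0 \<and> cyc_ends m D = E} \<subseteq> {{}}"
    using finite_subset[OF _ finite_lessThan[of m]] by (auto simp: card_eq_0_iff)
  from card_mono[OF _ this] show ?case by simp
next
  case (Suc d)
  let ?T = "\<lambda>E d. {D. D \<subseteq> {..<m} \<and> card D = d \<and> cyc_ends m D = E}"
  have fin: "finite (?T E d)" for E d by (rule finite_subset[of _ "Pow {..<m}"]) auto
  show ?case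
  \<comment> \<open>A set without ends is empty or the whole cycle, and positive size leaves only
    the latter.\<close>
  proof (cases "E = {}")
    case True
    have "?T E (Suc d) \<subseteq> {{..<m}}"
    proof
      fix D assume "D \<in> ?T E (Suc d)"
      then have D: "D \<subseteq> {..<m}" "card D = Suc d" "cyc_ends m D = {}" using True by auto
      then have "D \<noteq> {}" by auto
      then show "D \<in> {{..<m}}" using cyc_ends_empty_imp_full D by blast
    qed
    from card_mono[OF _ this] have "card (?T E (Suc d)) \<le> 1" by simp
    also have "\<dots> \<le> 2 ^ Suc d" by simp
    finally show ?thesis .
  next
    case False
    then obtain e where e: "e \<in> E" by auto
    define e' where "e' = (e + (m - 1)) mod m"
    have eD: "e \<in> D" if "D \<in> ?T E (Suc d)" for D using that e by (auto simp: cyc_ends_def)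
    have inj: "inj_on (\<lambda>D. D - {e}) (?T E (Suc d))"
    proof (rule inj_onI)
      fix D D' assume a: "D \<in> ?T E (Suc d)" "D' \<in> ?T E (Suc d)" "D - {e} = D' - {e}"
      then show "D = D'" using eD[OF a(1)] eD[OF a(2)] by blast
    qed
    have img: "(\<lambda>D. D - {e}) ` ?T E (Suc d) \<subseteq> ?T (E - {e}) d \<union> ?T (insert e' (E - {e})) d"
    proof
      fix F assume "F \<in> (\<lambda>D. D - {e}) ` ?T E (Suc d)"
      then obtain D where F: "F = D - {e}" and D: "D \<in> ?T E (Suc d)" by auto
      have Dm: "D \<subseteq> {..<m}" "card D = Suc d" "cyc_ends m D = E" using D by auto
      have em: "e < m" using eD[OF D] Dm(1) by auto
      have card: "card F = d" using eD[OF D] Dm F by simp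
      have pre: "{j \<in> D - {e}. Suc j mod m = e} \<subseteq> {e'}"
      proof
        fix j assume j: "j \<in> {j \<in> D - {e}. Suc j mod m = e}"
        then have "j < m" using Dm by auto
        have "e' = (Suc j + (m - 1)) mod m" unfolding e'_def using j by (metis (mono_tags, lifting) mem_Collect_eq mod_add_left_eq)
        then show "j \<in> {e'}" using \<open>j < m\<close> by simp
      qed
      have "cyc_ends m F = (E - {e}) \<union> {j \<in> D - {e}. Suc j mod m = e}"
        using Dm(3) eD[OF D] unfolding F by (auto simp: cyc_ends_def)
      then have "cyc_ends m F = E - {e} \<or> cyc_ends m F = insert e' (E - {e})" using pre by auto
      moreover have "F \<subseteq> {..<m}" using F Dm by auto
      ultimately show "F \<in> ?T (E - {e}) d \<union> ?T (insert e' (E - {e})) d" using card by auto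
    qed
    have "card (?T E (Suc d)) \<le> card (?T (E - {e}) d \<union> ?T (insert e' (E - {e})) d)"
      using fin by (intro card_inj_on_le[OF inj img]) auto
    also have "\<dots> \<le> card (?T (E - {e}) d) + card (?T (insert e' (E - {e})) d)"
      by (rule card_Un_le)
    also have "\<dots> \<le> 2 ^ d + 2 ^ d" by (intro add_mono Suc.IH)
    finally show ?thesis by simp
  qed
qed

text \<open>First choose the set of nonempty cells, of some size at most \<open>t\<close>: at most
  \<open>1 + 2 + \<dots> + 2 ^ t\<close> ways. Then choose the edges in these cells: at most
  \<open>8 ^ t\<close> ways.\<close>

lemma card_labels_fixed_ends_le:
  "card {J. J \<subseteq> {..<m} \<times> {..<3::nat} \<and> card J = t \<and> cyc_ends m (fst ` J) = E} \<le> 2 * 16 ^ t"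
proof -
  let ?\<J> = "{J. J \<subseteq> {..<m} \<times> {..<3::nat} \<and> card J = t \<and> cyc_ends m (fst ` J) = E}"
  let ?\<D> = "\<Union>d\<le>t. {D. D \<subseteq> {..<m} \<and> card D = d \<and> cyc_ends m D = E}"
  have fin: "finite {D. D \<subseteq> {..<m} \<and> card D = d \<and> cyc_ends m D = E}" for d
    by (rule finite_subset[of _ "Pow {..<m}"]) auto
  have "card ?\<D> \<le> (\<Sum>d\<le>t. card {D. D \<subseteq> {..<m} \<and> card D = d \<and> cyc_ends m D = E})"
    by (rule card_UN_le) simp
  also have "\<dots> \<le> (\<Sum>d\<le>t. 2 ^ d)" by (intro sum_mono card_fixed_cyc_ends_le)
  also have "\<dots> \<le> 2 * 2 ^ t" by (induction t) auto
  finally have D: "card ?\<D> \<le> 2 * 2 ^ t" .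
  have sub: "?\<J> \<subseteq> (\<Union>D\<in>?\<D>. Pow (D \<times> {..<3}))"
  proof
    fix J assume J: "J \<in> ?\<J>"
    then have "finite J" by (auto intro: finite_subset)
    then have "card (fst ` J) \<le> t" using J card_image_le by fastforce
    moreover have "fst ` J \<subseteq> {..<m}" "J \<subseteq> fst ` J \<times> {..<3}" using J by force+
    ultimately show "J \<in> (\<Union>D\<in>?\<D>. Pow (D \<times> {..<3}))" using J by (intro UN_I[of "fst ` J"]) auto
  qed
  have finP: "finite (Pow (D \<times> {..<3::nat}))" if "D \<in> ?\<D>" for D
    using that by (auto intro: finite_subset)
  have finD: "finite ?\<D>" using fin by auto
  have "card ?\<J> \<le> card (\<Union>D\<in>?\<D>. Pow (D \<times> {..<3::nat}))"
    by (rule card_mono[OF finite_UN_I[OF finD finP] sub])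
  also have "\<dots> \<le> (\<Sum>D\<in>?\<D>. card (Pow (D \<times> {..<3::nat})))"
    by (rule card_UN_le[OF finD])
  also have "\<dots> \<le> (\<Sum>D\<in>?\<D>. 8 ^ t)"
  proof (rule sum_mono)
    fix D assume D: "D \<in> ?\<D>"
    then have "finite D" "card D \<le> t" by (auto intro: finite_subset)
    then have "card (Pow (D \<times> {..<3::nat})) = 8 ^ card D"
      by (simp add: card_Pow card_cartesian_product mult.commute[of _ 3] power_mult)
    also have "\<dots> \<le> 8 ^ t" using \<open>card D \<le> t\<close> by (intro power_increasing) auto
    finally show "card (Pow (D \<times> {..<3::nat})) \<le> 8 ^ t" .
  qed
  also have "\<dots> = card ?\<D> * 8 ^ t" by simp
  also have "\<dots> \<le> 2 * 2 ^ t * 8 ^ t" using D by (rule mult_right_mono) simp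
  also have "\<dots> = 2 * 16 ^ t" by (simp flip: power_mult_distrib)
  finally show ?thesis .
qed

lemma sum_Pow_power_card:
  fixes y :: "'a::comm_semiring_1"
  assumes "finite B"
  shows "(\<Sum>E\<in>Pow B. y ^ card E) = (1 + y) ^ card B"
  using prod_add[OF assms, of "\<lambda>_. y" "\<lambda>_. 1"] by (simp add: add.commute)

text \<open>Sort the sets \<open>J\<close> by their set \<open>E\<close> of ends, which is a subset
  of the cells of \<open>J0\<close>. Each \<open>E\<close> arises from at most
  \<open>2 * 16 ^ t\<close> sets, and the binomial theorem sums \<open>y ^ card E\<close> to at most
  \<open>(1 + y) ^ card J0\<close>.\<close>

lemma sum_cyc_ends_weight_le:
  fixes y :: real and J0 :: "(nat \<times> nat) set"
  assumes J0: "J0 \<subseteq> {..<m} \<times> {..<3}" and y: "0 \<le> y"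
  shows "(\<Sum>J\<in>{J. J \<subseteq> J0 \<and> card J = t}. y ^ card (cyc_ends m (fst ` J))) \<le> 2 * 16 ^ t * exp (y * real (card J0))"
proof -
  let ?\<J> = "{J. J \<subseteq> J0 \<and> card J = t}" and ?B = "fst ` J0" and ?e = "\<lambda>J. cyc_ends m (fst ` J)"
  have finJ0: "finite J0" using J0 by (auto intro: finite_subset)
  then have fin: "finite ?\<J>" by auto
  have "(\<Sum>J\<in>?\<J>. y ^ card (?e J)) = (\<Sum>E\<in>Pow ?B. \<Sum>J\<in>{J \<in> ?\<J>. ?e J = E}. y ^ card (?e J))"
    using fin finJ0 by (intro sum.group[symmetric]) (auto simp: cyc_ends_def)
  also have "\<dots> = (\<Sum>E\<in>Pow ?B. real (card {J \<in> ?\<J>. ?e J = E}) * y ^ card E)"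
  proof (rule sum.cong[OF refl])
    fix E
    have "(\<Sum>J\<in>{J \<in> ?\<J>. ?e J = E}. y ^ card (?e J)) = (\<Sum>J\<in>{J \<in> ?\<J>. ?e J = E}. y ^ card E)"
      by (rule sum.cong) auto
    then show "(\<Sum>J\<in>{J \<in> ?\<J>. ?e J = E}. y ^ card (?e J)) = real (card {J \<in> ?\<J>. ?e J = E}) * y ^ card E"
      by (simp only: sum_constant)
  qed
  also have "\<dots> \<le> (\<Sum>E\<in>Pow ?B. 2 * 16 ^ t * y ^ card E)"
  proof (intro sum_mono mult_right_mono)
    fix E
    have "card {J \<in> ?\<J>. ?e J = E} \<le> card {J. J \<subseteq> {..<m} \<times> {..<3::nat} \<and> card J = t \<and> cyc_ends m (fst ` J) = E}"
    proof (rule card_mono)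
      show "finite {J. J \<subseteq> {..<m} \<times> {..<3::nat} \<and> card J = t \<and> cyc_ends m (fst ` J) = E}"
        by (rule finite_subset[of _ "Pow ({..<m} \<times> {..<3::nat})"]) auto
    qed (use J0 in auto)
    also have "\<dots> \<le> 2 * 16 ^ t" by (rule card_labels_fixed_ends_le)
    finally have "real (card {J \<in> ?\<J>. ?e J = E}) \<le> real (2 * 16 ^ t)" by (simp only: of_nat_le_iff)
    then show "real (card {J \<in> ?\<J>. ?e J = E}) \<le> 2 * 16 ^ t" by simp
  qed (use y in auto)
  also have "\<dots> = 2 * 16 ^ t * (1 + y) ^ card ?B"
    using finJ0 by (simp add: sum_distrib_left[symmetric] sum_Pow_power_card)
  also have "\<dots> \<le> 2 * 16 ^ t * exp (y * real (card J0))"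
  proof (rule mult_left_mono)
    have "(1 + y) ^ card ?B \<le> (1 + y) ^ card J0"
      using y finJ0 by (intro power_increasing card_image_le) auto
    also have "\<dots> \<le> exp y ^ card J0"
      using y exp_ge_add_one_self[of y] by (intro power_mono) auto
    also have "\<dots> = exp (y * real (card J0))" by (simp only: exp_of_nat2_mult)
    finally show "(1 + y) ^ card ?B \<le> exp (y * real (card J0))" .
  qed simp
  finally show ?thesis .
qed

section \<open>Spread of the copies of the ladder\<close>

lemma ladder_edge_subset: "0 < m \<Longrightarrow> ladder_edge m x \<subseteq> {1..2 * m}"
proof -
  assume m: "0 < m"
  have "2 * (j mod m) + 2 \<le> 2 * m" for j using mod_less_divisor[OF m, of j] by linarith
  then have "ladder_top m j \<in> {1..2 * m}" "ladder_bot m j \<in> {1..2 * m}" for j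
    by (simp_all add: ladder_top_def ladder_bot_def Suc_le_lessD less_imp_le)
  then show ?thesis by (cases x) (simp add: ladder_edge_def)
qed

lemma card_ladder_edge_le: "finite (ladder_edge m x) \<and> card (ladder_edge m x) \<le> 2"
  by (cases x) (auto simp: ladder_edge_def card_insert_if)

text \<open>The forest of \<open>J\<close> has rank at least \<open>(2 * t + c) / 3\<close>, up to a
  deficit of two, where \<open>c\<close> is the number of ends, and each unit of rank saves a factor
  of order \<open>n\<close>. In the constant, \<open>exp 2\<close> reflects that \<open>t\<close>
  edges have at most \<open>2 * t\<close> ends, and \<open>48 = 3 * 16\<close> combines the degree
  with the cost of the deficit.\<close>

lemma card_permutes_ladder_le:
  fixes m :: nat and J :: "(nat \<times> nat) set"
  assumes m: "2 \<le> m" and J: "J \<subseteq> {..<m} \<times> {..<3}"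
  defines "n \<equiv> real (2 * m)" and "t \<equiv> card J"
  shows "real (card {\<tau>. \<tau> permutes {1..2 * m} \<and> (\<forall>e\<in>ladder_edge m ` J. \<tau> ` e \<in> ladder_edge m ` ({..<m} \<times> {..<3}))})
     \<le> fact (2 * m) * (exp 2 * 48 * n powr (- 2 / 3)) ^ t * (n powr (- 1 / 3)) ^ card (cyc_ends m (fst ` J))"
proof -
  let ?V = "{1..2 * m}" and ?E = "ladder_edge m ` ({..<m} \<times> {..<3})"
  let ?U = "\<Union>(ladder_edge m ` J)" and ?c = "card (cyc_ends m (fst ` J))"
  have m0: "0 < m" using m by simp
  have finJ: "finite J" using J by (auto intro: finite_subset)
  obtain es where es: "peelable es" "\<forall>(x, y)\<in>set es. {x, y} \<in> ladder_edge m ` J" "length es \<le> t"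
    "2 * t + ?c \<le> 3 * length es + (if fst ` J = {..<m} then 6 else 0)"
    using ladder_forest_exists[OF J m0] unfolding t_def by blast
  have U: "fst ` set es \<union> snd ` set es \<subseteq> ?U" using es(2) by fastforce
  have UV: "?U \<subseteq> ?V" using ladder_edge_subset[OF m0] by blast
  have cardU: "card ?U \<le> 2 * t"
  proof -
    have "card ?U \<le> (\<Sum>x\<in>J. card (ladder_edge m x))" using finJ by (rule card_UN_le)
    also have "\<dots> \<le> (\<Sum>x\<in>J. 2)" using card_ladder_edge_le by (intro sum_mono) blast
    finally show ?thesis by (simp add: t_def mult.commute)
  qed
  have n4: "4 \<le> n" using m by (simp add: n_def)
  let ?A = "{\<tau>. \<tau> permutes ?V \<and> (\<forall>e\<in>ladder_edge m ` J. \<tau> ` e \<in> ?E)}"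
  let ?B = "{\<sigma>. \<sigma> permutes ?V \<and> (\<forall>(x, y)\<in>set es. {\<sigma> x, \<sigma> y} \<in> ?E)}"
  have sub: "?A \<subseteq> ?B"
  proof clarify
    fix \<tau> x y assume t: "\<forall>e\<in>ladder_edge m ` J. \<tau> ` e \<in> ?E" "(x, y) \<in> set es"
    have "{x, y} \<in> ladder_edge m ` J" using es(2) t(2) by blast
    from bspec[OF t(1) this] have "\<tau> ` {x, y} \<in> ?E" .
    then show "{\<tau> x, \<tau> y} \<in> ?E" by simp
  qed
  have "finite ?B" using finite_permutations[of ?V] by (rule rev_finite_subset) auto
  then have "real (card ?A) \<le> real (card ?B)" using sub by (simp add: card_mono)
  also have "\<dots> \<le> fact (card ?V) * exp (real (card ?U)) * (real 3 / real (card ?V)) ^ length es"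
    by (rule card_permutes_peelable_le[where nb = "\<lambda>u v. {u, v} \<in> ?E", OF _ ladder_degree[OF m0] es(1) U UV])
       (use m in auto)
  also have "\<dots> = fact (2 * m) * (exp (real (card ?U)) * (3 ^ length es * (1 / n) ^ length es))"
    by (simp add: n_def power_divide)
  also have "\<dots> \<le> fact (2 * m) * (exp 2 ^ t * (3 ^ t * (16 ^ t * n powr (- (2 * real t + real ?c) / 3))))"
  proof (intro mult_left_mono mult_mono)
    have "exp (real (card ?U)) \<le> exp (2 * real t)" using cardU by simp
    then show "exp (real (card ?U)) \<le> exp 2 ^ t" by (simp only: exp_of_nat2_mult)
    show "(3::real) ^ length es \<le> 3 ^ t" using es(3) by (intro power_increasing) auto
    \<comment> \<open>The deficit in rank is \<open>6 / 3\<close>, and it occurs only if no cell is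
      empty.\<close>
    let ?b = "if fst ` J = {..<m} then 2 else 0 :: real"
    have "real (2 * t + ?c) \<le> real (3 * length es + (if fst ` J = {..<m} then 6 else 0))"
      using es(4) by (simp only: of_nat_le_iff)
    then have len: "- real (length es) \<le> ?b + - (2 * real t + real ?c) / 3" by (auto simp: field_simps split: if_splits)
    \<comment> \<open>A set that meets all cells has \<open>t \<ge> m\<close> edges, so the factor
      \<open>n ^ 2 \<le> 16 ^ m\<close> is absorbed by \<open>16 ^ t\<close>.\<close>
    have b: "n powr ?b \<le> 16 ^ t"
    proof (cases "fst ` J = {..<m}")
      case True
      have "m = card (fst ` J)" using True by simp
      also have "\<dots> \<le> t" unfolding t_def using finJ by (rule card_image_le)
      finally have mt: "m \<le> t" .
      have "2 * m \<le> 4 ^ m"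
      proof (induction m)
        case (Suc k)
        have "2 * Suc k = 2 * k + 2 * 1" by simp
        also have "\<dots> \<le> 4 ^ k + 2 * 4 ^ k" by (intro add_mono Suc.IH mult_le_mono2) simp
        also have "\<dots> \<le> 4 ^ Suc k" by simp
        finally show ?case .
      qed simp
      then have "real (2 * m) \<le> real (4 ^ m)" by (simp only: of_nat_le_iff)
      then have "n \<le> 4 ^ m" by (simp add: n_def)
      then have "n ^ 2 \<le> (4 ^ m) ^ 2" using n4 by (intro power_mono) auto
      also have "\<dots> = (4 ^ 2) ^ m" by (simp only: power_mult[symmetric] mult.commute)
      also have "\<dots> \<le> 16 ^ t" using mt by (simp add: power_increasing)
      finally show ?thesis using True n4 by (simp add: powr_numeral)
    qed (use n4 in simp)
    have "(1 / n) ^ length es = n powr (- real (length es))"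
      using n4 by (simp add: powr_minus powr_realpow power_one_over inverse_eq_divide)
    also have "\<dots> \<le> n powr (?b + - (2 * real t + real ?c) / 3)"
      using len n4 by (intro powr_mono) auto
    also have "\<dots> = n powr ?b * n powr (- (2 * real t + real ?c) / 3)" by (rule powr_add)
    also have "\<dots> \<le> 16 ^ t * n powr (- (2 * real t + real ?c) / 3)"
      using b by (rule mult_right_mono) simp
    finally show "(1 / n) ^ length es \<le> 16 ^ t * n powr (- (2 * real t + real ?c) / 3)" .
  qed (use n4 in auto)
  also have "n powr (- (2 * real t + real ?c) / 3) = (n powr (- 2 / 3)) ^ t * (n powr (- 1 / 3)) ^ ?c"
  proof -
    have "(n powr (- 2 / 3)) ^ t = n powr (- 2 / 3 * real t)"
      "(n powr (- 1 / 3)) ^ ?c = n powr (- 1 / 3 * real ?c)"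
      using n4 by (simp_all add: powr_powr flip: powr_realpow)
    moreover have "- (2 * real t + real ?c) / 3 = - 2 / 3 * real t + - 1 / 3 * real ?c"
      by (simp add: field_simps)
    ultimately show ?thesis by (simp only: powr_add)
  qed
  also have "fact (2 * m) * (exp 2 ^ t * (3 ^ t * (16 ^ t * ((n powr (- 2 / 3)) ^ t * (n powr (- 1 / 3)) ^ ?c)))) =
     fact (2 * m) * (exp 2 * (3 * 16) * n powr (- 2 / 3)) ^ t * (n powr (- 1 / 3)) ^ ?c"
    by (simp only: power_mult_distrib mult.assoc)
  finally show ?thesis by simp
qed

text \<open>The product of \<open>exp 2 * 48\<close> from \<open>card_permutes_ladder_le\<close> and
  \<open>32 * exp 10\<close> from the sum over edge sets.\<close>

definition spread_const :: real where
  "spread_const = exp 12 * 1536"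

text \<open>Pass from edges to their labels and sum the previous bound over all \<open>J\<close>
  with the weight \<open>y = n powr (- 1 / 3)\<close> per end. The lower bound on \<open>t\<close>
  turns the factor \<open>exp (y * card A)\<close> into at most \<open>exp 10 ^ t\<close>.\<close>

lemma sum_permutes_ladder_le:
  fixes m t :: nat
  assumes m: "2 \<le> m" and A: "A \<subseteq> ladder_edge m ` ({..<m} \<times> {..<3})"
    and t: "1 \<le> t" "real (card A) * real (2 * m) powr (- 1 / 3) / 10 \<le> real t"
  shows "(\<Sum>I\<in>{I. I \<subseteq> A \<and> card I = t}.
      real (card {\<tau>. \<tau> permutes {1..2 * m} \<and> (\<forall>e\<in>I. \<tau> ` e \<in> ladder_edge m ` ({..<m} \<times> {..<3}))}))
    \<le> fact (2 * m) * (spread_const * real (2 * m) powr (- 2 / 3)) ^ t"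
proof -
  let ?L = "{..<m} \<times> {..<3::nat}"
  define n where "n = real (2 * m)"
  define y where "y = n powr (- 1 / 3)"
  define N where "N I = real (card {\<tau>. \<tau> permutes {1..2 * m} \<and> (\<forall>e\<in>I. \<tau> ` e \<in> ladder_edge m ` ?L)})" for I
  \<comment> \<open>One label is chosen for every edge; for \<open>m = 2\<close> different labels
    may name the same edge.\<close>
  define s where "s = inv_into ?L (ladder_edge m)"
  have s: "s e \<in> ?L" "ladder_edge m (s e) = e" if "e \<in> A" for e
    using that A inv_into_into[of e "ladder_edge m" ?L] f_inv_into_f[of e "ladder_edge m" ?L]
    unfolding s_def by blast+
  have inj_s: "inj_on s A" using s(2) by (metis inj_onI)
  have img_s: "ladder_edge m ` s ` I = I" if "I \<subseteq> A" for I
    using s(2) that by (force simp: image_image)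
  have finA: "finite A" using A finite_surj[of ?L A "ladder_edge m"] by simp
  let ?J0 = "s ` A"
  have J0: "?J0 \<subseteq> ?L" using s(1) by blast
  have cardJ0: "card ?J0 = card A" by (rule card_image[OF inj_s])
  have inj_im: "inj_on (image s) {I. I \<subseteq> A \<and> card I = t}"
    by (rule inj_on_subset[OF inj_on_image_Pow[OF inj_s]]) auto
  have im: "image s ` {I. I \<subseteq> A \<and> card I = t} \<subseteq> {J. J \<subseteq> ?J0 \<and> card J = t}"
  proof clarify
    fix I assume I: "I \<subseteq> A" "t = card I"
    then show "s ` I \<subseteq> s ` A \<and> card (s ` I) = card I"
      using inj_on_subset[OF inj_s I(1)] by (auto simp: card_image)
  qed
  have "(\<Sum>I\<in>{I. I \<subseteq> A \<and> card I = t}. N I) = (\<Sum>I\<in>{I. I \<subseteq> A \<and> card I = t}. N (ladder_edge m ` s ` I))"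
    by (intro sum.cong refl) (use img_s in auto)
  also have "\<dots> = (\<Sum>J\<in>image s ` {I. I \<subseteq> A \<and> card I = t}. N (ladder_edge m ` J))"
    by (simp add: sum.reindex[OF inj_im])
  also have "\<dots> \<le> (\<Sum>J\<in>{J. J \<subseteq> ?J0 \<and> card J = t}. N (ladder_edge m ` J))"
    using im finA by (intro sum_mono2) (auto simp: N_def)
  also have "\<dots> \<le> (\<Sum>J\<in>{J. J \<subseteq> ?J0 \<and> card J = t}.
      fact (2 * m) * (exp 2 * 48 * n powr (- 2 / 3)) ^ t * y ^ card (cyc_ends m (fst ` J)))"
  proof (rule sum_mono)
    fix J assume J: "J \<in> {J. J \<subseteq> ?J0 \<and> card J = t}"
    then have "J \<subseteq> ?L" "card J = t" using J0 by blast+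
    then show "N (ladder_edge m ` J) \<le> fact (2 * m) * (exp 2 * 48 * n powr (- 2 / 3)) ^ t * y ^ card (cyc_ends m (fst ` J))"
      using card_permutes_ladder_le[OF m, of J] unfolding N_def n_def y_def by blast
  qed
  also have "\<dots> = fact (2 * m) * (exp 2 * 48 * n powr (- 2 / 3)) ^ t *
     (\<Sum>J\<in>{J. J \<subseteq> ?J0 \<and> card J = t}. y ^ card (cyc_ends m (fst ` J)))"
    by (rule sum_distrib_left[symmetric])
  also have "\<dots> \<le> fact (2 * m) * (exp 2 * 48 * n powr (- 2 / 3)) ^ t * (2 * 16 ^ t * exp (y * real (card A)))"
    using sum_cyc_ends_weight_le[OF J0, of y t] unfolding cardJ0
    by (intro mult_left_mono) (auto simp: y_def)
  also have "\<dots> \<le> fact (2 * m) * (exp 2 * 48 * n powr (- 2 / 3)) ^ t * (32 ^ t * exp 10 ^ t)"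
  proof (intro mult_left_mono mult_mono)
    have "(2::real) * 16 ^ t \<le> 2 ^ t * 16 ^ t" using t(1) power_increasing[of 1 t "2::real"] by simp
    then show "(2::real) * 16 ^ t \<le> 32 ^ t" by (simp flip: power_mult_distrib)
    have "y * real (card A) \<le> 10 * real t" using t(2) by (simp add: y_def n_def mult.commute)
    then have "exp (y * real (card A)) \<le> exp (10 * real t)" by simp
    then show "exp (y * real (card A)) \<le> exp 10 ^ t" by (simp only: exp_of_nat2_mult)
  qed auto
  also have "\<dots> = fact (2 * m) * ((exp 2 * 48 * n powr (- 2 / 3)) * (32 * exp 10)) ^ t"
    by (simp only: power_mult_distrib mult.assoc)
  also have "(exp 2 * 48 * n powr (- 2 / 3)) * (32 * exp 10) = spread_const * n powr (- 2 / 3)"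
  proof -
    have "exp 2 * exp 10 = exp (12::real)" by (simp flip: exp_add)
    then show ?thesis unfolding spread_const_def by (simp flip: \<open>exp 2 * exp 10 = exp (12::real)\<close>)
  qed
  finally show ?thesis unfolding N_def n_def .
qed

text \<open>The binomial coefficient counts the \<open>t\<close>-subsets of \<open>A\<close> inside
  a copy; exchange the two sums. By symmetry the copy \<open>\<rho>\<close> may be moved to the base
  ladder, which reduces the claim to \<open>sum_permutes_ladder_le\<close>.\<close>

lemma ladder_copies_spread:
  fixes m t :: nat
  defines "S \<equiv> \<lambda>\<sigma>. image \<sigma> ` (ladder_edge m ` ({..<m} \<times> {..<3}))"
  assumes m: "2 \<le> m" and \<rho>: "\<rho> permutes {1..2 * m}" and A: "A \<subseteq> S \<rho>"
    and t: "1 \<le> t" "real (card A) * real (2 * m) powr (- 1 / 3) / 10 \<le> real t"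
  shows "(\<Sum>\<sigma>\<in>{\<sigma>. \<sigma> permutes {1..2 * m}}. real (card (S \<sigma> \<inter> A) choose t))
     \<le> fact (2 * m) * (spread_const * real (2 * m) powr (- 2 / 3)) ^ t"
proof -
  let ?E = "ladder_edge m ` ({..<m} \<times> {..<3::nat})" and ?X = "{\<sigma>. \<sigma> permutes {1..2 * m}}"
  have finX: "finite ?X" by (rule finite_permutations) simp
  have finA: "finite A" using A finite_surj[of ?E A "image \<rho>"] unfolding S_def by simp
  let ?P = "\<lambda>I. I \<subseteq> A \<and> card I = t"
  define A0 where "A0 = {e \<in> ?E. \<rho> ` e \<in> A}"
  have inj_\<rho>: "inj (image \<rho>)" by (rule injI) (simp only: inj_image_eq_iff[OF permutes_inj[OF \<rho>]])
  have inj_\<rho>2: "inj (image (image \<rho>))" by (rule injI) (simp only: inj_image_eq_iff[OF inj_\<rho>])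
  have A_eq: "A = image \<rho> ` A0" using A unfolding A0_def S_def by blast
  have cardA0: "card A0 = card A" unfolding A_eq using inj_\<rho> by (simp add: card_image inj_on_subset)
  have "(\<Sum>\<sigma>\<in>?X. real (card (S \<sigma> \<inter> A) choose t)) = (\<Sum>\<sigma>\<in>?X. \<Sum>I\<in>{I. ?P I}. of_bool (I \<subseteq> S \<sigma>))"
  proof (rule sum.cong[OF refl])
    fix \<sigma>
    have "card (S \<sigma> \<inter> A) choose t = card {I. I \<subseteq> S \<sigma> \<inter> A \<and> card I = t}"
      using finA by (intro n_subsets[symmetric]) auto
    also have "{I. I \<subseteq> S \<sigma> \<inter> A \<and> card I = t} = {I. ?P I} \<inter> {I. I \<subseteq> S \<sigma>}" by auto
    finally show "real (card (S \<sigma> \<inter> A) choose t) = (\<Sum>I\<in>{I. ?P I}. of_bool (I \<subseteq> S \<sigma>))"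
      using finA by simp
  qed
  also have "\<dots> = (\<Sum>I\<in>{I. ?P I}. \<Sum>\<sigma>\<in>?X. of_bool (I \<subseteq> S \<sigma>))" by (rule sum.swap)
  also have "\<dots> = (\<Sum>I\<in>{I. ?P I}. real (card {\<sigma> \<in> ?X. I \<subseteq> S \<sigma>}))"
    using finX by (intro sum.cong refl) (simp add: Int_def)
  also have "{I. ?P I} = image (image \<rho>) ` {I. I \<subseteq> A0 \<and> card I = t}"
  proof -
    have "I \<in> image (image \<rho>) ` {I. I \<subseteq> A0 \<and> card I = t}" if I: "I \<subseteq> A" "card I = t" for I
    proof -
      obtain I0 where "I0 \<subseteq> A0" "I = image \<rho> ` I0" using I(1) unfolding A_eq by (metis subset_imageE)
      moreover have "card (image \<rho> ` I0) = card I0" using inj_\<rho> by (simp add: card_image inj_on_subset)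
      ultimately show ?thesis using I(2) by auto
    qed
    moreover have "card (image \<rho> ` I0) = card I0" for I0 using inj_\<rho> by (simp add: card_image inj_on_subset)
    ultimately show ?thesis unfolding A_eq by auto
  qed
  also have "(\<Sum>I\<in>image (image \<rho>) ` {I. I \<subseteq> A0 \<and> card I = t}. real (card {\<sigma> \<in> ?X. I \<subseteq> S \<sigma>})) =
     (\<Sum>I\<in>{I. I \<subseteq> A0 \<and> card I = t}. real (card {\<sigma> \<in> ?X. image \<rho> ` I \<subseteq> S \<sigma>}))"
    by (subst sum.reindex) (use inj_\<rho>2 in \<open>auto intro: inj_on_subset\<close>)
  also have "\<dots> \<le> (\<Sum>I\<in>{I. I \<subseteq> A0 \<and> card I = t}. real (card {\<tau>. \<tau> permutes {1..2 * m} \<and> (\<forall>e\<in>I. \<tau> ` e \<in> ?E)}))"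
  proof (intro sum_mono of_nat_mono)
    fix I
    show "card {\<sigma> \<in> ?X. image \<rho> ` I \<subseteq> S \<sigma>} \<le> card {\<tau>. \<tau> permutes {1..2 * m} \<and> (\<forall>e\<in>I. \<tau> ` e \<in> ?E)}"
    \<comment> \<open>That the copy \<open>\<sigma>\<close> contains the \<open>\<rho>\<close>-image
      of \<open>I\<close> means that \<open>inv \<sigma> \<circ> \<rho>\<close> sends the edges of
      \<open>I\<close> to ladder edges.\<close>
    proof (rule card_inj_on_le[where f = "\<lambda>\<sigma>. inv \<sigma> \<circ> \<rho>"])
      show "inj_on (\<lambda>\<sigma>. inv \<sigma> \<circ> \<rho>) {\<sigma> \<in> ?X. image \<rho> ` I \<subseteq> S \<sigma>}"
      proof (rule inj_onI)
        fix \<sigma> \<sigma>' assume s: "\<sigma> \<in> {\<sigma> \<in> ?X. image \<rho> ` I \<subseteq> S \<sigma>}" "\<sigma>' \<in> {\<sigma> \<in> ?X. image \<rho> ` I \<subseteq> S \<sigma>}"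
          and eq: "inv \<sigma> \<circ> \<rho> = inv \<sigma>' \<circ> \<rho>"
        have "inv \<sigma> = inv \<sigma>'" using eq permutes_surj[OF \<rho>] by (metis surj_fun_eq)
        then show "\<sigma> = \<sigma>'" using s by (metis (mono_tags, lifting) mem_Collect_eq permutes_inv_inv)
      qed
      show "(\<lambda>\<sigma>. inv \<sigma> \<circ> \<rho>) ` {\<sigma> \<in> ?X. image \<rho> ` I \<subseteq> S \<sigma>} \<subseteq> {\<tau>. \<tau> permutes {1..2 * m} \<and> (\<forall>e\<in>I. \<tau> ` e \<in> ?E)}"
      proof clarify
        fix \<sigma> assume s: "\<sigma> permutes {1..2 * m}" "image \<rho> ` I \<subseteq> S \<sigma>"
        have "(inv \<sigma> \<circ> \<rho>) permutes {1..2 * m}" using s \<rho> by (intro permutes_compose permutes_inv)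
        moreover have "(inv \<sigma> \<circ> \<rho>) ` e \<in> ?E" if "e \<in> I" for e
        proof -
          have "\<rho> ` e \<in> S \<sigma>" using s(2) that by blast
          then obtain e' where e': "\<rho> ` e = \<sigma> ` e'" "e' \<in> ?E" unfolding S_def by (rule imageE)
          have "(inv \<sigma> \<circ> \<rho>) ` e = inv \<sigma> ` \<sigma> ` e'" using e'(1) by (simp only: image_comp[symmetric])
          also have "\<dots> = e'" using permutes_inj[OF s(1)] by (simp only: image_inv_f_f)
          finally show ?thesis using e'(2) by simp
        qed
        ultimately show "(inv \<sigma> \<circ> \<rho>) permutes {1..2 * m} \<and> (\<forall>e\<in>I. (inv \<sigma> \<circ> \<rho>) ` e \<in> ?E)" by blast
      qed
      show "finite {\<tau>. \<tau> permutes {1..2 * m} \<and> (\<forall>e\<in>I. \<tau> ` e \<in> ?E)}"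
        using finX by (rule rev_finite_subset) auto
    qed
  qed
  also have "\<dots> \<le> fact (2 * m) * (spread_const * real (2 * m) powr (- 2 / 3)) ^ t"
    using t by (intro sum_permutes_ladder_le[OF m]) (auto simp: cardA0, auto simp: A0_def)
  finally show ?thesis .
qed

section \<open>The threshold\<close>

abbreviation ladder_edges :: "nat \<Rightarrow> nat set set" where
  "ladder_edges m \<equiv> ladder_edge m ` ({..<m} \<times> {..<3})"

text \<open>Two labels on one side could name the same edge only if the cells were successors of
  each other, which needs \<open>m \<le> 2\<close>. This yields exactly \<open>3 * m\<close> edges
  for the union bound.\<close>

lemma inj_on_ladder_edge:
  assumes "3 \<le> m"
  shows "inj_on (ladder_edge m) ({..<m} \<times> {..<3})"
proof -
  have no2: "\<not> (j mod m = Suc j' mod m \<and> Suc j mod m = j' mod m)" for j j'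
  proof
    assume a: "j mod m = Suc j' mod m \<and> Suc j mod m = j' mod m"
    then have "Suc (Suc j) mod m = j mod m" by (metis mod_Suc_eq)
    then show False using mod_neq_in_window[of j "Suc (Suc j)" m] assms by simp
  qed
  have "j = j' \<and> s = s'" if "ladder_edge m (j, s) = ladder_edge m (j', s')" "j < m" "j' < m" "s < 3" "s' < 3" for j j' s s'
  proof -
    have s: "s \<in> {0, 1, 2}" "s' \<in> {0, 1, 2}" using that by auto
    have jj: "j mod m = j" "j' mod m = j'" using that by auto
    from s show ?thesis
      using that(1) no2[of j j']
      by (elim insertE emptyE) (auto simp: ladder_edge_def doubleton_eq_iff jj)
  qed
  then show ?thesis by (fastforce simp: inj_on_def)
qed

lemma card_ladder_edges: "3 \<le> m \<Longrightarrow> card (ladder_edges m) = 3 * m"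
  by (simp add: card_image[OF inj_on_ladder_edge] card_cartesian_product mult.commute)

lemma ladder_edges_subset:
  assumes m: "2 \<le> m"
  shows "ladder_edges m \<subseteq> all_pairs {1..2 * m}"
proof clarify
  fix j s
  have "card (ladder_edge m (j, s)) = 2"
    using mod_neq_in_window[of j "Suc j" m] m by (simp add: ladder_edge_def card_insert_if)
  then show "ladder_edge m (j, s) \<in> all_pairs {1..2 * m}"
    using ladder_edge_subset[of m "(j, s)"] m by (simp add: all_pairs_def)
qed

lemma finite_all_pairs: "finite V \<Longrightarrow> finite (all_pairs V)"
  by (rule finite_subset[of _ "Pow V"]) (auto simp: all_pairs_def)

lemma permutes_image_all_pairs:
  assumes "\<sigma> permutes V" "e \<in> all_pairs V"
  shows "\<sigma> ` e \<in> all_pairs V"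
proof -
  have "\<sigma> ` e \<subseteq> V" using assms permutes_image[OF assms(1)] by (auto simp: all_pairs_def)
  moreover have "card (\<sigma> ` e) = card e"
    using permutes_inj[OF assms(1)] by (simp add: card_image inj_on_subset)
  ultimately show ?thesis using assms by (simp add: all_pairs_def)
qed

text \<open>The graph is spanning, so an embedding is an injective self-map of a finite set, hence a
  bijection; extended by the identity it becomes a permutation.\<close>

lemma contains_copy_C4e_iff:
  assumes "2 \<le> m"
  shows "contains_copy ({1..2 * m}, W) (C4e (2 * m)) \<longleftrightarrow>
     (\<exists>\<sigma>\<in>{\<sigma>. \<sigma> permutes {1..2 * m}}. image \<sigma> ` ladder_edges m \<subseteq> W)"
proof
  let ?V = "{1..2 * m}"
  have fst: "fst (C4e (2 * m)) = ?V" by (simp add: C4e_def)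
  {
    assume "contains_copy (?V, W) (C4e (2 * m))"
    then obtain \<phi> where \<phi>: "inj_on \<phi> ?V" "\<phi> ` ?V \<subseteq> ?V" "\<forall>e\<in>ladder_edges m. \<phi> ` e \<in> W"
      unfolding contains_copy_def fst C4e_edges fst_conv snd_conv by (elim exE conjE) (rule that)
    define \<sigma> where "\<sigma> x = (if x \<in> ?V then \<phi> x else x)" for x
    have "\<phi> ` ?V = ?V" using \<phi> by (intro endo_inj_surj) auto
    then have "bij_betw \<phi> ?V ?V" using \<phi>(1) by (simp add: bij_betw_def)
    then have "bij_betw \<sigma> ?V ?V" by (rule bij_betw_cong[THEN iffD1, rotated]) (simp add: \<sigma>_def)
    then have "\<sigma> permutes ?V" by (rule bij_imp_permutes) (auto simp: \<sigma>_def)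
    moreover have "image \<sigma> ` ladder_edges m \<subseteq> W"
    proof (rule image_subsetI)
      fix e assume "e \<in> ladder_edges m"
      then obtain x where x: "e = ladder_edge m x" "x \<in> {..<m} \<times> {..<3}" by (rule imageE)
      then have "\<phi> ` ladder_edge m x \<in> W" using \<phi>(3) by blast
      moreover have "\<sigma> ` ladder_edge m x = \<phi> ` ladder_edge m x"
        using ladder_edge_subset[of m x] assms by (intro image_cong refl) (auto simp: \<sigma>_def)
      ultimately show "\<sigma> ` e \<in> W" using x by simp
    qed
    ultimately show "\<exists>\<sigma>\<in>{\<sigma>. \<sigma> permutes ?V}. image \<sigma> ` ladder_edges m \<subseteq> W" by blast
  next
    assume "\<exists>\<sigma>\<in>{\<sigma>. \<sigma> permutes ?V}. image \<sigma> ` ladder_edges m \<subseteq> W"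
    then obtain \<sigma> where s: "\<sigma> permutes ?V" "image \<sigma> ` ladder_edges m \<subseteq> W" by blast
    have "inj_on \<sigma> ?V" using permutes_inj[OF s(1)] by (rule inj_on_subset) simp
    moreover have "\<sigma> ` ?V \<subseteq> ?V" using permutes_image[OF s(1)] by simp
    ultimately show "contains_copy (?V, W) (C4e (2 * m))"
      unfolding contains_copy_def fst C4e_edges using s(2) by (intro exI[of _ \<sigma>]) auto
  }
qed

lemma prob_gnp_contains_C4e:
  assumes "2 \<le> m" "0 \<le> p" "p \<le> 1"
  shows "measure_pmf.prob (gnp (2 * m) p) {G. contains_copy G (C4e (2 * m))} =
    bern_exp (all_pairs {1..2 * m}) p
      (\<lambda>W. of_bool (\<exists>\<sigma>\<in>{\<sigma>. \<sigma> permutes {1..2 * m}}. image \<sigma> ` ladder_edges m \<subseteq> W))"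
proof -
  let ?M = "all_pairs {1..2 * m}"
  have "measure_pmf.prob (gnp (2 * m) p) {G. contains_copy G (C4e (2 * m))} =
     measure_pmf.prob (Pi_pmf ?M False (\<lambda>_. bernoulli_pmf p))
       {X. contains_copy ({1..2 * m}, {e \<in> ?M. X e}) (C4e (2 * m))}"
    unfolding gnp_def by (simp add: vimage_def)
  also have "\<dots> = bern_exp ?M p (\<lambda>W. of_bool (contains_copy ({1..2 * m}, W) (C4e (2 * m))))"
    using assms finite_all_pairs by (intro prob_Pi_pmf_bernoulli) auto
  finally show ?thesis unfolding contains_copy_C4e_iff[OF assms(1)] .
qed

text \<open>The union bound gives \<open>fact (2 * m) * p ^ (3 * m)\<close>. With
  \<open>r = p / n powr (- 2 / 3)\<close> this is at most \<open>r ^ (3 * m)\<close>, because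
  \<open>n ^ (2 * m)\<close> is the power \<open>3 * m\<close> of \<open>n powr (2 / 3)\<close>;
  finally \<open>r \<le> 1\<close>.\<close>

lemma prob_contains_C4e_le:
  assumes m: "3 \<le> m" and p: "0 \<le> p" "p \<le> 1" and small: "p / real (2 * m) powr (- 2 / 3) \<le> 1"
  shows "measure_pmf.prob (gnp (2 * m) p) {G. contains_copy G (C4e (2 * m))} \<le> p / real (2 * m) powr (- 2 / 3)"
proof -
  let ?M = "all_pairs {1..2 * m}" and ?X = "{\<sigma>. \<sigma> permutes {1..2 * m}}"
  define n where "n = real (2 * m)"
  define r where "r = p / n powr (- 2 / 3)"
  have n0: "0 < n" using m by (simp add: n_def)
  have r: "0 \<le> r" "r \<le> 1" using p small by (auto simp: r_def n_def)
  have finX: "finite ?X" by (rule finite_permutations) simp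
  have finM: "finite ?M" by (simp add: finite_all_pairs)
  have S: "image \<sigma> ` ladder_edges m \<subseteq> ?M" "card (image \<sigma> ` ladder_edges m) = 3 * m" if "\<sigma> \<in> ?X" for \<sigma>
  proof -
    have "2 \<le> m" using m by simp
    from ladder_edges_subset[OF this] show "image \<sigma> ` ladder_edges m \<subseteq> ?M"
      using permutes_image_all_pairs that by blast
    have "inj (image \<sigma>)"
      using that by (intro injI) (simp add: inj_image_eq_iff permutes_inj)
    then have "card (image \<sigma> ` ladder_edges m) = card (ladder_edges m)"
      by (intro card_image) (rule inj_on_subset, auto)
    then show "card (image \<sigma> ` ladder_edges m) = 3 * m" using card_ladder_edges[OF m] by simp
  qed
  have "measure_pmf.prob (gnp (2 * m) p) {G. contains_copy G (C4e (2 * m))} =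
    bern_exp ?M p (\<lambda>W. of_bool (\<exists>\<sigma>\<in>?X. image \<sigma> ` ladder_edges m \<subseteq> W))"
    using m p by (intro prob_gnp_contains_C4e) auto
  also have "\<dots> \<le> bern_exp ?M p (\<lambda>W. \<Sum>\<sigma>\<in>?X. of_bool (image \<sigma> ` ladder_edges m \<subseteq> W))"
  proof (rule bern_exp_mono[OF p])
    fix W
    show "(of_bool (\<exists>\<sigma>\<in>?X. image \<sigma> ` ladder_edges m \<subseteq> W) :: real) \<le> (\<Sum>\<sigma>\<in>?X. of_bool (image \<sigma> ` ladder_edges m \<subseteq> W))"
    proof (cases "\<exists>\<sigma>\<in>?X. image \<sigma> ` ladder_edges m \<subseteq> W")
      case True
      then obtain \<sigma> where s: "\<sigma> \<in> ?X" "image \<sigma> ` ladder_edges m \<subseteq> W" by blast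
      have "(of_bool (image \<sigma> ` ladder_edges m \<subseteq> W) :: real) \<le> (\<Sum>\<sigma>\<in>?X. of_bool (image \<sigma> ` ladder_edges m \<subseteq> W))"
        by (rule member_le_sum[OF s(1) _ finX]) simp
      moreover have "(of_bool (image \<sigma> ` ladder_edges m \<subseteq> W) :: real) = 1" using s(2) by simp
      moreover have "(of_bool (\<exists>\<sigma>\<in>?X. image \<sigma> ` ladder_edges m \<subseteq> W) :: real) \<le> 1" by simp
      ultimately show ?thesis by linarith
    next
      case False
      then have "(of_bool (\<exists>\<sigma>\<in>?X. image \<sigma> ` ladder_edges m \<subseteq> W) :: real) = 0" by (simp only: of_bool_eq)
      then show ?thesis by (simp only:) (intro sum_nonneg, simp)
    qed
  qed
  also have "\<dots> = (\<Sum>\<sigma>\<in>?X. p ^ (3 * m))"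
    unfolding bern_exp_sum
    by (intro sum.cong refl) (simp only: bern_exp_superset_prob[OF finM S(1)] S(2))
  also have "\<dots> = fact (2 * m) * p ^ (3 * m)"
    using card_permutations[of "{1..2 * m}" "2 * m"] by simp
  also have "\<dots> \<le> n ^ (2 * m) * p ^ (3 * m)"
    using p fact_le_power[of "2 * m", where 'a = real] by (intro mult_right_mono) (auto simp: n_def)
  also have "\<dots> = r ^ (3 * m)"
  proof -
    have "(n powr (- 2 / 3)) ^ (3 * m) = n powr (- 2 / 3 * real (3 * m))"
      using n0 by (simp only: powr_powr[symmetric] powr_realpow powr_gt_zero)
    also have "- 2 / 3 * real (3 * m) = - real (2 * m)" by simp
    also have "n powr - real (2 * m) = 1 / n ^ (2 * m)"
      using n0 by (simp only: powr_minus powr_realpow inverse_eq_divide)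
    finally show ?thesis unfolding r_def by (simp add: power_divide)
  qed
  also have "\<dots> \<le> r ^ 1" using r m by (intro power_decreasing) auto
  finally show ?thesis by (simp add: r_def n_def)
qed

text \<open>Three rounds of equal probability \<open>q\<close> are run. Each multiplies the size
  bound by \<open>y / 10\<close>, gives up a quarter of the copies and adds
  \<open>8 * \<theta> / q\<close> to the failure probability; the total
  \<open>24 * \<theta> / q\<close> is at most \<open>72 * \<theta> / p\<close>.\<close>

lemma prob_contains_C4e_ge:
  assumes m: "2 \<le> m" and p: "0 < p" "p \<le> 1"
    and large: "spread_const * real (2 * m) powr (- 2 / 3) \<le> p / 6"
  shows "1 - 72 * spread_const * (real (2 * m) powr (- 2 / 3) / p) \<le>
    measure_pmf.prob (gnp (2 * m) p) {G. contains_copy G (C4e (2 * m))}"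
proof -
  define M where "M = all_pairs {1..2 * m}"
  define X where "X = {\<sigma>. \<sigma> permutes {1..2 * m}}"
  define S where "S \<sigma> = image \<sigma> ` ladder_edges m" for \<sigma> :: "nat \<Rightarrow> nat"
  define n where "n = real (2 * m)"
  define y where "y = n powr (- 1 / 3)"
  define \<theta> where "\<theta> = spread_const * n powr (- 2 / 3)"
  \<comment> \<open>Chosen so that \<open>(1 - q) ^ 3 = 1 - p\<close>: the union of the three rounds
    has probability exactly \<open>p\<close>.\<close>
  define q where "q = 1 - root 3 (1 - p)"
  have finM: "finite M" by (simp add: M_def finite_all_pairs)
  have finX: "finite X" unfolding X_def by (rule finite_permutations) simp
  have X0: "X \<noteq> {}" unfolding X_def using permutes_id by blast
  have cardX: "card X = fact (2 * m)" using card_permutations[of "{1..2 * m}" "2 * m"] by (simp add: X_def)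
  have SM: "S \<sigma> \<subseteq> M" if "\<sigma> \<in> X" for \<sigma>
    using ladder_edges_subset[OF m] permutes_image_all_pairs that unfolding S_def X_def M_def by blast
  have cardS: "card (S \<sigma>) \<le> 3 * m" for \<sigma>
  proof -
    have "card (S \<sigma>) \<le> card ({..<m} \<times> {..<3::nat})"
      unfolding S_def by (rule order_trans[OF card_image_le card_image_le]) auto
    then show ?thesis by (simp add: card_cartesian_product mult.commute)
  qed
  have n0: "0 < n" using m by (simp add: n_def)
  have y0: "0 < y" using n0 by (simp add: y_def)
  have q3: "(1 - q) ^ 3 = 1 - p" using p by (simp add: q_def)
  \<comment> \<open>Bernoulli's inequality shows that splitting loses at most a factor 3, that is,
    \<open>q \<ge> p / 3\<close>.\<close>
  have "root 3 (1 - p) \<le> 1 - p / 3"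
  proof -
    have "1 - p \<le> (1 - p / 3) ^ 3"
      using Bernoulli_inequality[of "- p / 3" 3] p by simp
    then have "root 3 (1 - p) \<le> root 3 ((1 - p / 3) ^ 3)" by simp
    also have "\<dots> = 1 - p / 3" using p by (intro real_root_power_cancel) auto
    finally show ?thesis .
  qed
  then have qp: "p / 3 \<le> q" by (simp add: q_def)
  then have q0: "0 < q" using p by simp
  have q1: "q \<le> 1" using p by (simp add: q_def)
  have \<theta>0: "0 \<le> \<theta>" by (simp add: \<theta>_def spread_const_def)
  have \<theta>q: "\<theta> \<le> q / 2" using large qp by (simp add: \<theta>_def n_def)
  have step: "covering_failure_bound M X S (1 - (1 - q) * (1 - q')) k (g + 1 / 4) (\<epsilon> + 8 * \<theta> / q)"
    if "0 \<le> q'" "q' \<le> 1" "0 \<le> \<epsilon>" "0 \<le> k" "covering_failure_bound M X S q' (k * y / 10) g \<epsilon>" for q' k g \<epsilon>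
  proof (rule covering_failure_bound_step[OF finM finX X0 SM q0 q1 that(1,2) \<theta>0 \<theta>q _ _ that(5,3)])
    fix j A t
    assume a: "j \<in> X" "A \<subseteq> S j" "real (card A) \<le> k" "1 \<le> t" "k * y / 10 \<le> real t"
    have "real (card A) * y / 10 \<le> k * y / 10" using a(3) y0 by simp
    then have "real (card A) * real (2 * m) powr (- 1 / 3) / 10 \<le> real t" using a(5) by (simp add: y_def n_def)
    then have "(\<Sum>i\<in>X. real (card (S i \<inter> A) choose t)) \<le> fact (2 * m) * \<theta> ^ t"
      using ladder_copies_spread[OF m _ _ a(4), of j A] a(1,2)
      unfolding \<theta>_def n_def S_def X_def by simp
    then show "(\<Sum>i\<in>X. real (card (S i \<inter> A) choose t)) \<le> real (card X) * \<theta> ^ t"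
      unfolding cardX of_nat_fact .
  qed (use that y0 in auto)
  define k0 where "k0 = real (3 * m)"
  have k0: "0 \<le> k0" by (simp add: k0_def)
  have y3: "y * y * y = 1 / n"
  proof -
    have "y * y * y = n powr (- 1 / 3 + - 1 / 3 + - 1 / 3)" unfolding y_def by (simp only: powr_add)
    also have "\<dots> = n powr - 1" by simp
    finally show ?thesis using n0 by (simp add: powr_minus inverse_eq_divide)
  qed
  have "k0 * y / 10 * y / 10 * y / 10 = k0 * (y * y * y) / 1000" by simp
  also have "\<dots> < 1" unfolding y3 using m by (simp add: k0_def n_def)
  finally have k3: "k0 * y / 10 * y / 10 * y / 10 < 1" .
  have finS: "finite (S \<sigma>)" if "\<sigma> \<in> X" for \<sigma> using SM[OF that] finM by (rule finite_subset)
  \<comment> \<open>The rounds are assembled from the last one backwards. After three of them the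
    size bound is \<open>3 * m / (1000 * n) < 1\<close>, so nothing more has to be exposed.\<close>
  have r0: "covering_failure_bound M X S 0 (k0 * y / 10 * y / 10 * y / 10) (1 / 4) 0"
    by (rule covering_failure_bound_0[OF finX X0 finS _ k3]) auto
  have sq: "0 \<le> 1 - (1 - q) * (1 - q)" "1 - (1 - q) * (1 - q) \<le> 1"
    using mult_nonneg_nonneg[of "1 - q" "1 - q"] mult_le_one[of "1 - q" "1 - q"] q0 q1 by auto
  have r1: "covering_failure_bound M X S q (k0 * y / 10 * y / 10) (1 / 2) (8 * \<theta> / q)"
    using step[OF _ _ _ _ r0] k0 y0 by simp
  have r2: "covering_failure_bound M X S (1 - (1 - q) * (1 - q)) (k0 * y / 10) (3 / 4) (16 * \<theta> / q)"
    using step[OF _ _ _ _ r1] k0 y0 q0 q1 \<theta>0 by simp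
  have r3: "covering_failure_bound M X S (1 - (1 - q) * (1 - (1 - (1 - q) * (1 - q)))) k0 1 (24 * \<theta> / q)"
    using step[OF sq _ _ r2] k0 q0 \<theta>0 by simp
  have "1 - (1 - q) * (1 - (1 - (1 - q) * (1 - q))) = p"
    using q3 by (simp add: power3_eq_cube)
  with r3 have "covering_failure_bound M X S p k0 1 (24 * \<theta> / q)" by simp
  \<comment> \<open>The first round starts with all permutations and their complete copies, so
    \<open>g = 1\<close> and \<open>k0 = 3 * m\<close>.\<close>
  then have fail: "bern_exp M p (\<lambda>W. of_bool (\<not> (\<exists>\<sigma>\<in>X. S \<sigma> \<subseteq> W))) \<le> 24 * \<theta> / q"
    unfolding covering_failure_bound_def using cardS by (auto simp: k0_def simp del: of_nat_mult)
  have "24 * \<theta> / q \<le> 24 * \<theta> / (p / 3)"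
    using \<theta>0 p qp q0 by (intro divide_left_mono) auto
  also have "\<dots> = 72 * spread_const * (n powr (- 2 / 3) / p)" by (simp add: \<theta>_def)
  finally have le: "24 * \<theta> / q \<le> 72 * spread_const * (n powr (- 2 / 3) / p)" .
  have "bern_exp M p (\<lambda>W. of_bool (\<exists>\<sigma>\<in>X. S \<sigma> \<subseteq> W)) + bern_exp M p (\<lambda>W. of_bool (\<not> (\<exists>\<sigma>\<in>X. S \<sigma> \<subseteq> W))) = bern_exp M p (\<lambda>_. 1)"
    unfolding bern_exp_add[symmetric] by (intro arg_cong[of _ _ "bern_exp M p"]) auto
  also have "\<dots> = 1" by (rule bern_exp_const[OF finM])
  finally have "1 - 24 * \<theta> / q \<le> bern_exp M p (\<lambda>W. of_bool (\<exists>\<sigma>\<in>X. S \<sigma> \<subseteq> W))" using fail by linarith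
  also have "\<dots> = measure_pmf.prob (gnp (2 * m) p) {G. contains_copy G (C4e (2 * m))}"
    unfolding M_def X_def S_def using p by (intro prob_gnp_contains_C4e[OF m, symmetric]) auto
  finally show ?thesis using le by (simp add: n_def)
qed

section \<open>From the probability bounds to the limits along even numbers\<close>

lemma eventually_even_at_top:
  assumes "\<And>m. m0 \<le> m \<Longrightarrow> P (2 * m)"
  shows "eventually P even_at_top"
  unfolding even_at_top_def eventually_inf_principal
  using eventually_ge_at_top[of "2 * m0"] by eventually_elim (use assms in \<open>auto elim!: evenE\<close>)

theorem theorem1p1:
  "\<exists>pstar :: nat \<Rightarrow> real.
     pstar \<in> \<Theta>[even_at_top](\<lambda>n. real n powr (- 2 / 3)) \<and>
     is_threshold even_at_top (\<lambda>n. {G. contains_copy G (C4e n)}) pstar"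
proof (intro exI conjI)
  let ?g = "\<lambda>n. real n powr (- 2 / 3)"
  let ?P = "\<lambda>p n. measure_pmf.prob (gnp n (p n)) {G. contains_copy G (C4e n)}"
  show "?g \<in> \<Theta>[even_at_top](?g)" by (rule bigtheta_refl)
  show "is_threshold even_at_top (\<lambda>n. {G. contains_copy G (C4e n)}) ?g"
    unfolding is_threshold_def
  proof (intro allI impI conjI)
    fix p :: "nat \<Rightarrow> real" assume p: "\<forall>n. 0 \<le> p n \<and> p n \<le> 1"
    {
      assume "p \<in> o[even_at_top](?g)"
      then have lim: "((\<lambda>n. p n / ?g n) \<longlongrightarrow> 0) even_at_top" by (rule smalloD_tendsto)
      then have "\<forall>\<^sub>F n in even_at_top. p n / ?g n < 1" by (rule order_tendstoD) simp
      moreover have "\<forall>\<^sub>F n in even_at_top. p n / ?g n \<le> 1 \<longrightarrow> ?P p n \<le> p n / ?g n"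
        by (rule eventually_even_at_top[of 3]) (use p prob_contains_C4e_le in blast)
      ultimately have up: "\<forall>\<^sub>F n in even_at_top. ?P p n \<le> p n / ?g n" by eventually_elim simp
      show "(?P p \<longlongrightarrow> 0) even_at_top"
        by (rule tendsto_sandwich[OF _ up tendsto_const lim]) simp
    next
      assume "p \<in> \<omega>[even_at_top](?g)"
      then have small: "?g \<in> o[even_at_top](p)" by (simp only: smallomega_iff_smallo)
      then have lim: "((\<lambda>n. ?g n / p n) \<longlongrightarrow> 0) even_at_top" by (rule smalloD_tendsto)
      have K0: "0 < spread_const" by (simp add: spread_const_def)
      \<comment> \<open>The constant \<open>1 / (6 * spread_const)\<close> is what the hypothesis
        \<open>large\<close> of \<open>prob_contains_C4e_ge\<close> requires.\<close>
      have "\<forall>\<^sub>F n in even_at_top. norm (?g n) \<le> 1 / (6 * spread_const) * norm (p n)"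
        using small K0 by (intro landau_o.smallD) auto
      moreover have "\<forall>\<^sub>F n in even_at_top. norm (?g n) \<le> 1 / (6 * spread_const) * norm (p n) \<longrightarrow>
         1 - 72 * spread_const * (?g n / p n) \<le> ?P p n"
      proof (rule eventually_even_at_top[of 2], rule impI)
        fix m :: nat
        assume m: "2 \<le> m" and le: "norm (?g (2 * m)) \<le> 1 / (6 * spread_const) * norm (p (2 * m))"
        have pn: "0 \<le> p (2 * m)" "p (2 * m) \<le> 1" using p by auto
        have g0: "0 < ?g (2 * m)" using m by simp
        have "p (2 * m) \<noteq> 0" using le g0 by auto
        then have "0 < p (2 * m)" using pn by simp
        moreover have "spread_const * ?g (2 * m) \<le> p (2 * m) / 6"
          using le g0 pn K0 by (simp add: field_simps)
        ultimately show "1 - 72 * spread_const * (?g (2 * m) / p (2 * m)) \<le> ?P p (2 * m)"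
          using prob_contains_C4e_ge[OF m _ pn(2)] by blast
      qed
      ultimately have low: "\<forall>\<^sub>F n in even_at_top. 1 - 72 * spread_const * (?g n / p n) \<le> ?P p n"
        by eventually_elim simp
      have up: "\<forall>\<^sub>F n in even_at_top. ?P p n \<le> 1" by simp
      have "((\<lambda>n. 1 - 72 * spread_const * (?g n / p n)) \<longlongrightarrow> 1 - 72 * spread_const * 0) even_at_top"
        by (intro tendsto_intros lim)
      then have "((\<lambda>n. 1 - 72 * spread_const * (?g n / p n)) \<longlongrightarrow> 1) even_at_top" by simp
      then show "(?P p \<longlongrightarrow> 1) even_at_top"
        by (rule tendsto_sandwich[OF low up _ tendsto_const])
    }
  qed
qed

end
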